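(* Let $\kappa_1=\frac{2\log\frac{1+\sqrt5}{2}}{\log 2}$. (i) Let $x\in(0,1)$ be irrational and suppose there exists a constant $C$ such that for all natural $t$ one has $$S_x(t)\le \kappa_1 t+\frac{\log t}{\log 2}+C.$$ Then $?'(x)$ exists and $?'(x)=+\infty$. (ii) Let $\psi(t)$ be an increasing function such that $\lim_{t\to+\infty}\psi(t)=+\infty$. Then there exists an irrational number $x\in(0,1)$ such that $?'(x)$ does not exist and for any $t$ one has $$S_x(t)\le \kappa_1 t+\frac{\log t}{\log 2}+\psi(t).$$
   Context: The Minkowski question mark function $?:[0,1]\to[0,1]$ is the continuous increasing function defined by $?(0)=0$, $?(1)=1$, by $?\left(\frac{p+p'}{q+q'}\right)=\frac12\left(?\left(\frac pq\right)+?\left(\frac{p'}{q'}\right)\right)$ for consecutive Farey fractions $\frac pq,\frac{p'}{q'}$, and extended by continuity to irrationals. Equivalently, for irrational $x=[0;a_1,a_2,\dots]$, $?(x)=\frac1{2^{a_1-1}}-\frac1{2^{a_1+a_2-1}}+\dots+\frac{(-1)^{n+1}}{2^{a_1+\dots+a_n-1}}+\cdots$. The derivative $?'(x)$ is understood as the limit of $\frac{?(x+\delta)-?(x)}{\delta}$ as $\delta\to0$ (two-sided), and the value $+\infty$ is allowed (so "$?'(x)$ exists" means that the limit exists as a finite number or equals $+\infty$). For irrational $x\in(0,1)$ with regular continued fraction expansion $x=[0;a_1,a_2,\dots]$ (natural partial quotients) and natural $t$, $S_x(t)=a_1+a_2+\dots+a_t$.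
   Formalization: In (ii) the bound on S_x(t) is required only at those t≥1 where its right side is at least t; since S_x(t)≥t always, the literal claim fails for ψ with very negative initial values, such as ψ(t)=t−100. *)

theory Defs
  imports "HOL-Analysis.Analysis"
begin

definition farey :: "nat \<Rightarrow> real set" where
  "farey n = {real p / real q | p q. 0 < q \<and> q \<le> n \<and> p \<le> q}"

definition farey_consecutive :: "real \<Rightarrow> real \<Rightarrow> bool" where
  "farey_consecutive r s \<longleftrightarrow>
     (\<exists>n. r \<in> farey n \<and> s \<in> farey n \<and> r < s \<and> farey n \<inter> {r<..<s} = {})"

text \<open>Fractions must be in lowest terms for the mediant to make sense. The value 0 outside the
  unit interval only serves to make the function unique on the whole real line.\<close>

definition is_question_mark :: "(real \<Rightarrow> real) \<Rightarrow> bool" where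
  "is_question_mark f \<longleftrightarrow>
     f 0 = 0 \<and> f 1 = 1 \<and>
     (\<forall>p q p' q' :: nat. 0 < q \<and> 0 < q' \<and> coprime p q \<and> coprime p' q' \<and>
        farey_consecutive (real p / real q) (real p' / real q') \<longrightarrow>
        f (real (p + p') / real (q + q')) = (f (real p / real q) + f (real p' / real q')) / 2) \<and>
     continuous_on {0..1} f \<and> mono_on {0..1} f \<and>
     (\<forall>x. x \<notin> {0..1} \<longrightarrow> f x = 0)"

definition question_mark :: "real \<Rightarrow> real" where
  "question_mark = (THE f. is_question_mark f)"

definition has_ext_deriv :: "(real \<Rightarrow> real) \<Rightarrow> real \<Rightarrow> ereal \<Rightarrow> bool" where
  "has_ext_deriv f x L \<longleftrightarrow> ((\<lambda>\<delta>. ereal ((f (x + \<delta>) - f x) / \<delta>)) \<longlongrightarrow> L) (at 0)"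

text \<open>A derivative may be finite or \<open>+\<infinity>\<close>, but not \<open>-\<infinity>\<close>.\<close>

definition ext_deriv_exists :: "(real \<Rightarrow> real) \<Rightarrow> real \<Rightarrow> bool" where
  "ext_deriv_exists f x \<longleftrightarrow> (\<exists>L. L \<noteq> -\<infinity> \<and> has_ext_deriv f x L)"

definition gauss_map :: "real \<Rightarrow> real" where
  "gauss_map y = frac (1 / y)"

text \<open>For irrational \<open>x\<close> in the open unit interval, \<open>cf_quot x i\<close> with \<open>i \<ge> 1\<close> is the partial
  quotient \<open>a\<^sub>i\<close> of \<open>x = [0; a\<^sub>1, a\<^sub>2, \<dots>]\<close>; the index 0 is not meaningful.\<close>

definition cf_quot :: "real \<Rightarrow> nat \<Rightarrow> nat" where
  "cf_quot x i = nat \<lfloor>1 / (gauss_map ^^ (i - 1)) x\<rfloor>"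

definition cf_sum :: "real \<Rightarrow> nat \<Rightarrow> nat" where
  "cf_sum x t = (\<Sum>i = 1..t. cf_quot x i)"

definition kappa1 :: real where
  "kappa1 = 2 * ln ((1 + sqrt 5) / 2) / ln 2"

text \<open>In the existence statement about a function \<open>\<psi>\<close> tending to infinity, \<open>\<psi>\<close> may start with
  arbitrarily negative values, whereas \<open>cf_sum x t \<ge> t\<close> for every irrational \<open>x\<close> in the unit
  interval. The upper bound there is therefore demanded exactly at those \<open>t \<ge> 1\<close> at which it is
  at least \<open>t\<close>: at every \<open>t\<close> if \<open>\<psi>\<close> is nonnegative, and at all large \<open>t\<close> in any case.\<close>

end

theory Submission
  imports Defs "HOL-Real_Asymp.Real_Asymp"
begin

text \<open>Two neighbours \<open>p/q\<close>, \<open>p'/q'\<close> at level \<open>n\<close> of the Stern--Brocot tree are \<open>1/(q q')\<close> apart, while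
  the values of \<open>?\<close> differ by \<open>1/2^n\<close>, so \<open>?\<close> has slope \<open>q q'/2^n\<close> between them. The neighbours
  enclosing \<open>x\<close> are convergents and intermediate fractions, and the slopes are controlled by
  \<open>\<sigma>\<^sub>t = q\<^sub>t q\<^sub>t\<^sub>-\<^sub>1/2^S(t)\<close>: if \<open>\<sigma>\<^sub>t\<close> tends to infinity, the derivative is infinite, and if \<open>\<sigma>\<^sub>t\<close> oscillates,
  it does not exist.

  For (i), with \<open>B(t) = S(t) - t\<close> and the golden ratio \<open>\<phi>\<close>, the denominator \<open>q\<^sub>t\<close> is at least a constant
  times \<open>\<phi>^t (1 + B(t))\<close>. The hypothesis says \<open>2^S(t) \<le> const t \<phi>^(2t)\<close>. If \<open>B(t) < t/4\<close>, then
  \<open>2^S(t)\<close> is exponentially smaller than \<open>\<phi>^(2t)\<close>; otherwise \<open>B(t)\<close> compensates the factor \<open>t\<close> and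
  \<open>\<sigma>\<^sub>t\<close> is at least a constant times \<open>1 + B(t - 1)\<close>, which is unbounded.

  For (ii), all partial quotients are 1, which makes \<open>\<sigma>\<^sub>t\<close> grow, except that whenever \<open>\<sigma>\<^sub>t \<ge> 2\<close> and a
  single quotient within the bound brings \<open>\<sigma>\<close> down to at most 1, such a quotient is taken. This happens
  infinitely often because \<open>\<psi>\<close> eventually exceeds every constant.\<close>

section \<open>Stern--Brocot fractions and the question mark function\<close>

text \<open>Row 0 consists of the integers \<open>k\<close>. In each further row the even entries
  repeat the previous row and the odd ones are mediants. Indices \<open>k \<le> 2 ^ n\<close> cover
  the unit interval; the row goes on beyond it, so no range condition is needed in the
  inductions.\<close>

fun stern_num :: "nat \<Rightarrow> nat \<Rightarrow> nat" where
  "stern_num 0 k = k"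
| "stern_num (Suc n) k = (if even k then stern_num n (k div 2)
     else stern_num n (k div 2) + stern_num n (Suc (k div 2)))"

fun stern_den :: "nat \<Rightarrow> nat \<Rightarrow> nat" where
  "stern_den 0 k = 1"
| "stern_den (Suc n) k = (if even k then stern_den n (k div 2)
     else stern_den n (k div 2) + stern_den n (Suc (k div 2)))"

definition stern :: "nat \<Rightarrow> nat \<Rightarrow> real" where
  "stern n k = real (stern_num n k) / real (stern_den n k)"

lemma stern_den_pos: "0 < stern_den n k"
  by (induction n arbitrary: k) auto

text \<open>Replacing one of two neighbours by their mediant leaves the determinant
  unchanged.\<close>

lemma stern_unimodular:
  "stern_num n (Suc k) * stern_den n k = stern_num n k * stern_den n (Suc k) + 1"
proof (induction n arbitrary: k)
  case 0
  show ?case by simp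
next
  case (Suc n)
  show ?case
  proof (cases "even k")
    case True
    then obtain h where "k = 2 * h" by blast
    with Suc[of h] show ?thesis by (simp add: algebra_simps)
  next
    case False
    then obtain h where "k = 2 * h + 1" using oddE by blast
    with Suc[of h] show ?thesis by (simp add: algebra_simps)
  qed
qed

lemma stern_coprime: "coprime (stern_num n k) (stern_den n k)"
proof (rule coprimeI)
  fix d assume d: "d dvd stern_num n k" "d dvd stern_den n k"
  have "d dvd stern_num n k * stern_den n (Suc k) + 1"
    using d(2) stern_unimodular[of n k] by (metis dvd_mult)
  moreover have "d dvd stern_num n k * stern_den n (Suc k)" using d(1) by (rule dvd_mult2)
  ultimately show "d dvd 1" using dvd_add_right_iff by blast
qed

lemma stern_less_Suc: "stern n k < stern n (Suc k)"
proof -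
  have "real (stern_num n (Suc k)) * real (stern_den n k)
      = real (stern_num n k) * real (stern_den n (Suc k)) + 1"
    using stern_unimodular[of n k] by (metis of_nat_1 of_nat_add of_nat_mult)
  then show ?thesis
    using stern_den_pos[of n k] stern_den_pos[of n "Suc k"] by (simp add: stern_def divide_simps)
qed

lemma stern_strict_mono: "strict_mono (stern n)"
  by (simp add: stern_less_Suc strict_mono_Suc_iff)

lemma stern_double: "stern (Suc n) (2 * k) = stern n k"
  by (simp add: stern_def)

lemma stern_refine: "stern (n + i) (2 ^ i * k) = stern n k"
proof (induction i)
  case (Suc i)
  have "stern (n + Suc i) (2 ^ Suc i * k) = stern (Suc (n + i)) (2 * (2 ^ i * k))"
    by (simp add: mult.assoc)
  also have "\<dots> = stern n k" by (simp only: stern_double Suc)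
  finally show ?case .
qed simp

text \<open>Both fractions reappear in the common row \<open>m + n\<close>, which is strictly
  increasing. Hence the fractions are ordered exactly like their dyadic labels, the future values of
  \<open>?\<close>.\<close>

lemma stern_le_iff: "stern m j \<le> stern n k \<longleftrightarrow> real j / 2 ^ m \<le> real k / 2 ^ n"
proof -
  have "stern m j \<le> stern n k \<longleftrightarrow> stern (m + n) (2 ^ n * j) \<le> stern (m + n) (2 ^ m * k)"
    using stern_refine[of m n j] stern_refine[of n m k] by (simp add: add.commute)
  also have "\<dots> \<longleftrightarrow> 2 ^ n * j \<le> 2 ^ m * k"
    using stern_strict_mono strict_mono_less_eq by blast
  also have "\<dots> \<longleftrightarrow> real (2 ^ n * j) \<le> real (2 ^ m * k)" by (simp only: of_nat_le_iff)
  also have "\<dots> \<longleftrightarrow> real j / 2 ^ m \<le> real k / 2 ^ n" by (simp add: field_simps)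
  finally show ?thesis .
qed

lemma stern_0: "stern n 0 = 0"
  using stern_refine[of 0 n 0] by (simp add: stern_def)

lemma stern_1: "stern n (2 ^ n) = 1"
  using stern_refine[of 0 n 1] by (simp add: stern_def)

lemma stern_unit: "k \<le> 2 ^ n \<Longrightarrow> stern n k \<in> {0..1}"
  using strict_mono_less_eq[OF stern_strict_mono, of n k "2 ^ n"]
    strict_mono_less_eq[OF stern_strict_mono, of n 0 k]
  by (simp add: stern_1 stern_0)

lemma stern_locate:
  assumes "0 \<le> x" "x < 1"
  obtains k where "k < 2 ^ n" "stern n k \<le> x" "x < stern n (Suc k)"
proof -
  let ?k = "LEAST k. x < stern n (Suc k)"
  have "x < stern n (Suc (2 ^ n - 1))" using assms by (simp add: stern_1)
  then have 1: "x < stern n (Suc ?k)" and 2: "?k \<le> 2 ^ n - 1"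
    by (rule LeastI, rule Least_le)
  have 3: "stern n ?k \<le> x"
  proof (cases ?k)
    case 0
    then show ?thesis using assms by (simp add: stern_0)
  next
    case (Suc h)
    then show ?thesis using not_less_Least[of h "\<lambda>k. x < stern n (Suc k)"] by auto
  qed
  have "?k < 2 ^ n" using 2 by (metis Suc_pred' le_imp_less_Suc pos2 zero_less_power)
  with 1 3 that show thesis by blast
qed

text \<open>With neighbours p/q and p'/q', the integers uq - pv and p'v - uq' are positive, hence at
  least 1, and unimodularity gives v = q(p'v - uq') + q'(uq - pv).\<close>

lemma stern_gap:
  assumes 1: "stern n k < real u / real v" and 2: "real u / real v < stern n (Suc k)" and "0 < v"
  shows "stern_den n k + stern_den n (Suc k) \<le> v"
proof -
  let ?p = "int (stern_num n k)" and ?q = "int (stern_den n k)"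
  let ?p' = "int (stern_num n (Suc k))" and ?q' = "int (stern_den n (Suc k))"
  have pos: "?q > 0" "?q' > 0" using stern_den_pos by simp_all
  have "real (stern_num n k * v) < real (u * stern_den n k)"
    using 1 \<open>0 < v\<close> stern_den_pos[of n k] by (simp add: stern_def field_simps)
  then have "?p * int v < int u * ?q" by (metis of_nat_less_iff of_nat_mult)
  moreover have "real (u * stern_den n (Suc k)) < real (stern_num n (Suc k) * v)"
    using 2 \<open>0 < v\<close> stern_den_pos[of n "Suc k"] by (simp add: stern_def field_simps)
  then have "int u * ?q' < ?p' * int v" by (metis of_nat_less_iff of_nat_mult)
  ultimately have le: "?q' * 1 \<le> ?q' * (int u * ?q - ?p * int v)" "?q * 1 \<le> ?q * (?p' * int v - int u * ?q')"
    using pos by (intro mult_left_mono; simp)+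
  have "?p' * ?q = ?p * ?q' + 1" using stern_unimodular[of n k] by (metis of_nat_1 of_nat_add of_nat_mult)
  then have "int v = int v * (?p' * ?q - ?p * ?q')" by simp
  also have "\<dots> = ?q * (?p' * int v - int u * ?q') + ?q' * (int u * ?q - ?p * int v)"
    by (simp add: algebra_simps)
  finally show ?thesis using le by linarith
qed

text \<open>Every refinement adds at least 1 to the sum. This bounds the depth of the descent in
  \<open>farey_consecutive_stern\<close>.\<close>

lemma stern_den_sum_ge: "n + 2 \<le> stern_den n k + stern_den n (Suc k)"
proof (induction n arbitrary: k)
  case (Suc n)
  show ?case
  proof (cases "even k")
    case True
    then obtain h where "k = 2 * h" by blast
    with Suc[of h] stern_den_pos[of n h] show ?thesis by simp
  next
    case False
    then obtain h where "k = 2 * h + 1" using oddE by blast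
    with Suc[of h] stern_den_pos[of n "Suc h"] show ?thesis by simp
  qed
qed simp

section \<open>Farey neighbours are Stern--Brocot neighbours\<close>

lemma stern_farey: "k \<le> 2 ^ n \<Longrightarrow> stern_den n k \<le> N \<Longrightarrow> stern n k \<in> farey N"
proof -
  assume k: "k \<le> 2 ^ n" and N: "stern_den n k \<le> N"
  have "stern_num n k \<le> stern_den n k"
    using stern_unit[OF k] stern_den_pos[of n k] by (simp add: stern_def)
  then show ?thesis using N stern_den_pos[of n k] unfolding farey_def stern_def by blast
qed

text \<open>The witness is the Farey order given by the larger denominator: by
  \<open>stern_gap\<close> a fraction strictly between needs at least the sum of both
  denominators.\<close>

lemma stern_farey_consecutive:
  assumes "k < 2 ^ n"
  shows "farey_consecutive (stern n k) (stern n (Suc k))"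
proof -
  let ?N = "max (stern_den n k) (stern_den n (Suc k))"
  have "farey ?N \<inter> {stern n k<..<stern n (Suc k)} = {}"
  proof (rule ccontr)
    assume "farey ?N \<inter> {stern n k<..<stern n (Suc k)} \<noteq> {}"
    then obtain u v where "0 < v" "v \<le> ?N" "stern n k < real u / real v" "real u / real v < stern n (Suc k)"
      unfolding farey_def by auto
    with stern_gap[of n k u v] stern_den_pos[of n k] stern_den_pos[of n "Suc k"] show False by simp
  qed
  then show ?thesis using assms stern_farey[of k n ?N] stern_farey[of "Suc k" n ?N] stern_less_Suc
    unfolding farey_consecutive_def by (meson Suc_leI less_imp_le max.cobounded1 max.cobounded2)
qed

text \<open>Descend through the row intervals containing \<open>r\<close> until their mediant has
  denominator above \<open>N\<close>. Both endpoints then belong to \<open>farey N\<close> with no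
  member strictly between, which forces them to be \<open>r\<close> and \<open>s\<close>.\<close>

lemma farey_consecutive_stern:
  assumes "farey_consecutive r s"
  obtains n k where "k < 2 ^ n" "r = stern n k" "s = stern n (Suc k)"
proof -
  obtain N where r: "r \<in> farey N" and s: "s \<in> farey N" and rs: "r < s"
    and none: "farey N \<inter> {r<..<s} = {}"
    using assms unfolding farey_consecutive_def by blast
  obtain u v where uv: "r = real u / real v" "0 < v" "v \<le> N"
    using r unfolding farey_def by blast
  obtain u' v' where uv': "s = real u' / real v'" "0 < v'" "v' \<le> N" "u' \<le> v'"
    using s unfolding farey_def by blast
  have r0: "0 \<le> r" using uv by simp
  have r1: "r < 1" using rs uv' by (smt (verit) divide_le_eq_1 of_nat_0_less_iff of_nat_le_iff)
  define found where "found \<longleftrightarrow> (\<exists>n k. k < 2 ^ n \<and> stern n k \<le> r \<and> r < stern n (Suc k) \<and>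
    stern_den n k \<le> N \<and> stern_den n (Suc k) \<le> N \<and> N < stern_den n k + stern_den n (Suc k))"
  \<comment> \<open>Invariant: either the descent has already stopped, or the mediant of the
    interval around \<open>r\<close> in row \<open>n\<close> still has denominator at most
    \<open>N\<close>.\<close>
  have level: "found \<or> (\<exists>k<2 ^ n. stern n k \<le> r \<and> r < stern n (Suc k) \<and>
      stern_den n k + stern_den n (Suc k) \<le> N)" for n
  proof (induction n)
    case 0
    obtain k where k: "k < 2 ^ 0" "stern 0 k \<le> r" "r < stern 0 (Suc k)"
      using stern_locate[OF r0 r1, of 0] .
    show ?case
    proof (cases "N = 1")
      case True
      then have found unfolding found_def using k by (intro exI[of _ 0] exI[of _ k]) auto
      then show ?thesis ..
    next
      case False
      then show ?thesis using k uv by (intro disjI2 exI[of _ k]) auto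
    qed
  next
    case (Suc n)
    show ?case
    proof (cases found)
      case False
      with Suc obtain k where k: "k < 2 ^ n" "stern n k \<le> r" "r < stern n (Suc k)"
        "stern_den n k + stern_den n (Suc k) \<le> N" by blast
      obtain h where h: "h < 2 ^ Suc n" "stern (Suc n) h \<le> r" "r < stern (Suc n) (Suc h)"
        using stern_locate[OF r0 r1, of "Suc n"] .
      \<comment> \<open>The interval around \<open>r\<close> in the next row is one of the two
        halves cut off by the mediant.\<close>
      have "stern (Suc n) (2 * k) < stern (Suc n) (Suc h)"
        using h k stern_double[of n k] by linarith
      then have "2 * k < Suc h" using stern_strict_mono strict_mono_less by blast
      moreover have "stern (Suc n) h < stern (Suc n) (2 * Suc k)"
        using h k stern_double[of n "Suc k"] by linarith
      then have "h < 2 * Suc k" using stern_strict_mono strict_mono_less by blast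
      ultimately have "h = 2 * k \<or> h = Suc (2 * k)" by auto
      then have "stern_den (Suc n) h \<le> N" "stern_den (Suc n) (Suc h) \<le> N" using k(4) by auto
      with h show ?thesis unfolding found_def by (meson not_le)
    qed simp
  qed
  have found
  proof (rule ccontr)
    assume "\<not> found"
    with level[of N] obtain k where "stern_den N k + stern_den N (Suc k) \<le> N" by blast
    with stern_den_sum_ge[of N k] show False by linarith
  qed
  then obtain n k where k: "k < 2 ^ n" "stern n k \<le> r" "r < stern n (Suc k)"
    "stern_den n k \<le> N" "stern_den n (Suc k) \<le> N" "N < stern_den n k + stern_den n (Suc k)"
    unfolding found_def by blast
  have r_eq: "r = stern n k" using stern_gap[of n k u v] k uv by fastforce
  have "stern n (Suc k) \<in> farey N" using stern_farey k by simp
  with none k(3) have "s \<le> stern n (Suc k)" by fastforce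
  then have "s = stern n (Suc k)" using stern_gap[of n k u' v'] k uv' rs r_eq by fastforce
  with that k(1) r_eq show thesis by blast
qed

lemma stern_mediant:
  "real (stern_num n k + stern_num n (Suc k)) / real (stern_den n k + stern_den n (Suc k))
     = stern (Suc n) (Suc (2 * k))"
  by (simp add: stern_def)

section \<open>Uniqueness of the question mark function\<close>

lemma is_question_mark_stern:
  assumes f: "is_question_mark f"
  shows "k \<le> 2 ^ n \<Longrightarrow> f (stern n k) = real k / 2 ^ n"
proof -
  have med: "f (real (p + p') / real (q + q')) = (f (real p / real q) + f (real p' / real q')) / 2"
    if "0 < q" "0 < q'" "coprime p q" "coprime p' q'"
      "farey_consecutive (real p / real q) (real p' / real q')" for p q p' q' :: nat
    using f that unfolding is_question_mark_def by blast
  show "k \<le> 2 ^ n \<Longrightarrow> f (stern n k) = real k / 2 ^ n"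
  proof (induction n arbitrary: k)
    case 0
    then have "k = 0 \<or> k = 1" by auto
    then show ?case using f unfolding is_question_mark_def stern_def by auto
  next
    case (Suc n)
    show ?case
    proof (cases "even k")
      case True
      then obtain h where "k = 2 * h" by blast
      then show ?thesis using Suc.IH[of h] Suc.prems by (simp add: stern_double)
    next
      case False
      then have h: "k = Suc (2 * (k div 2))" using odd_two_times_div_two_succ[of k] by simp
      define h where "h = k div 2"
      note h = h[folded h_def]
      have hn: "h < 2 ^ n" using Suc.prems unfolding h by simp
      have "f (stern (Suc n) k) = (f (stern n h) + f (stern n (Suc h))) / 2"
        unfolding h stern_mediant[symmetric] unfolding stern_def
        using med[of "stern_den n h" "stern_den n (Suc h)" "stern_num n h" "stern_num n (Suc h)"]
          stern_farey_consecutive[OF hn, unfolded stern_def] by (simp add: stern_coprime stern_den_pos)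
      also have "\<dots> = real k / 2 ^ Suc n" using Suc.IH[of h] Suc.IH[of "Suc h"] hn h
        by (simp add: field_simps)
      finally show ?thesis .
    qed
qed
qed

text \<open>Monotonicity together with the forced values on row \<open>n\<close> places
  \<open>f x\<close> and \<open>g x\<close> in the same dyadic interval of length 1/2^n.\<close>

lemma is_question_mark_unique:
  assumes f: "is_question_mark f" and g: "is_question_mark g"
  shows "f = g"
proof
  fix x :: real
  have fm: "mono_on {0..1} f" and gm: "mono_on {0..1} g"
    using f g unfolding is_question_mark_def by blast+
  consider "x \<notin> {0..1}" | "x = 1" | "0 \<le> x" "x < 1" by fastforce
  then show "f x = g x"
  proof cases
    case 3
    have close: "\<bar>f x - g x\<bar> \<le> 1 / 2 ^ n" for n
    proof -
      obtain k where k: "k < 2 ^ n" "stern n k \<le> x" "x < stern n (Suc k)"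
        using stern_locate[OF 3] .
      have u: "stern n k \<in> {0..1}" "stern n (Suc k) \<in> {0..1}" "x \<in> {0..1}"
        using stern_unit[of k n] stern_unit[of "Suc k" n] k 3 by auto
      have "real k / 2 ^ n \<le> h x \<and> h x \<le> real (Suc k) / 2 ^ n"
        if "is_question_mark h" "mono_on {0..1} h" for h
        using is_question_mark_stern[OF that(1), of k n] is_question_mark_stern[OF that(1), of "Suc k" n]
          mono_onD[OF that(2) u(1,3) k(2)] mono_onD[OF that(2) u(3,2)] k by simp
      from this[OF f fm] this[OF g gm] show ?thesis by (simp add: add_divide_distrib) linarith
    qed
    have "(\<lambda>n. 1 / 2 ^ n :: real) \<longlonglongrightarrow> 0" by real_asymp
    then have "\<bar>f x - g x\<bar> \<le> 0" using close by (intro LIMSEQ_le_const) auto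
    then show ?thesis by simp
  qed (use f g in \<open>auto simp: is_question_mark_def\<close>)
qed

section \<open>Existence of the question mark function\<close>

text \<open>Extends the forced values monotonically from the Stern--Brocot fractions to the unit
  interval.\<close>

definition stern_sup :: "real \<Rightarrow> real" where
  "stern_sup x = (if x \<in> {0..1} then Sup {real k / 2 ^ n | n k. stern n k \<le> x} else 0)"

lemma bdd_above_stern: "x \<le> 1 \<Longrightarrow> bdd_above {real k / 2 ^ n | n k. stern n k \<le> x}"
proof (rule bdd_aboveI[of _ 1])
  fix y assume "x \<le> 1" "y \<in> {real k / 2 ^ n | n k. stern n k \<le> x}"
  then obtain n k where "y = real k / 2 ^ n" "stern n k \<le> stern 0 1" by (auto simp: stern_def)
  then show "y \<le> 1" by (simp only: stern_le_iff) simp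
qed

lemma stern_sup_stern: "k \<le> 2 ^ n \<Longrightarrow> stern_sup (stern n k) = real k / 2 ^ n"
  unfolding stern_sup_def using stern_unit[of k n]
  by (auto intro!: cSup_eq_maximum simp: stern_le_iff)

lemma stern_sup_mono: "mono_on {0..1} stern_sup"
proof (rule mono_onI)
  fix x y :: real assume xy: "x \<in> {0..1}" "y \<in> {0..1}" "x \<le> y"
  have "{real k / 2 ^ n | n k. stern n k \<le> x} \<noteq> {}"
    using xy stern_0 by (auto intro!: exI[of _ 0])
  then have "Sup {real k / 2 ^ n | n k. stern n k \<le> x} \<le> Sup {real k / 2 ^ n | n k. stern n k \<le> y}"
  proof (rule cSup_subset_mono)
    show "bdd_above {real k / 2 ^ n | n k. stern n k \<le> y}" using xy by (simp add: bdd_above_stern)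
    show "{real k / 2 ^ n | n k. stern n k \<le> x} \<subseteq> {real k / 2 ^ n | n k. stern n k \<le> y}"
      using xy(3) order_trans by blast
  qed
  then show "stern_sup x \<le> stern_sup y" unfolding stern_sup_def using xy by simp
qed

text \<open>Both points lie in one closed interval of row \<open>n\<close>, across which
  \<open>stern_sup\<close> rises by exactly 1/2^n.\<close>

lemma stern_sup_close:
  assumes "x \<in> {0..1}" "y \<in> {0..1}" "x < y"
    and none: "\<And>k. \<not> (x < stern n k \<and> stern n k < y)"
  shows "\<bar>stern_sup y - stern_sup x\<bar> \<le> 1 / 2 ^ n"
proof -
  obtain k where k: "k < 2 ^ n" "stern n k \<le> x" "x < stern n (Suc k)"
    using stern_locate[of x n] assms by auto
  have y: "y \<le> stern n (Suc k)" using none[of "Suc k"] k by linarith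
  have "stern n k \<in> {0..1}" "stern n (Suc k) \<in> {0..1}"
    using stern_unit[of k n] stern_unit[of "Suc k" n] k by auto
  then have "stern_sup (stern n k) \<le> stern_sup x" "stern_sup x \<le> stern_sup y"
    "stern_sup y \<le> stern_sup (stern n (Suc k))"
    using assms k y by (auto intro!: mono_onD[OF stern_sup_mono])
  then show ?thesis using stern_sup_stern[of k n] stern_sup_stern[of "Suc k" n] k
    by (simp add: add_divide_distrib)
qed

lemma stern_sup_continuous: "continuous_on {0..1} stern_sup"
  unfolding continuous_on_iff
proof (intro ballI allI impI)
  fix x e :: real assume x: "x \<in> {0..1}" and e: "0 < e"
  obtain n where n: "(1 / 2) ^ n < e" using real_arch_pow_inv[OF e, of "1/2"] by auto
  \<comment> \<open>Within distance \<open>d\<close> of \<open>x\<close>, no fraction of row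
    \<open>n\<close> in the unit interval other than possibly \<open>x\<close> itself occurs, so
    \<open>stern_sup_close\<close> applies.\<close>
  obtain d where d: "d > 0" "\<forall>z \<in> stern n ` {..2 ^ n}. z \<noteq> x \<longrightarrow> d \<le> dist x z"
    using finite_set_avoid[of "stern n ` {..2 ^ n}" x] by blast
  have far: "z \<noteq> x \<Longrightarrow> z = stern n k \<Longrightarrow> z \<le> 1 \<Longrightarrow> d \<le> dist x z" for z k
    using d(2) strict_mono_less_eq[OF stern_strict_mono, of n k "2 ^ n"] stern_1[of n] by auto
  have "dist (stern_sup y) (stern_sup x) < e" if y: "y \<in> {0..1}" "dist y x < d" for y
  proof -
    consider "x = y" | "x < y" | "y < x" by linarith
    then show ?thesis
    proof cases
      case 2
      have "\<not> (x < stern n k \<and> stern n k < y)" for k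
        using far[of "stern n k" k] y by (auto simp: dist_real_def)
      from stern_sup_close[OF x y(1) 2 this] n show ?thesis by (simp add: dist_real_def power_one_over)
    next
      case 3
      have "\<not> (y < stern n k \<and> stern n k < x)" for k
        using far[of "stern n k" k] y x by (auto simp: dist_real_def)
      from stern_sup_close[OF y(1) x 3 this] n show ?thesis
        by (simp add: dist_real_def power_one_over abs_minus_commute)
    qed (use e in simp)
  qed
  then show "\<exists>d>0. \<forall>y\<in>{0..1}. dist y x < d \<longrightarrow> dist (stern_sup y) (stern_sup x) < e"
    using d(1) by blast
qed

lemma coprime_fraction_unique:
  fixes p q r s :: nat
  assumes "real p / real q = real r / real s" "coprime p q" "coprime r s" "0 < q" "0 < s"
  shows "p = r" "q = s"
proof -
  have "real (p * s) = real (r * q)" using assms by (simp add: field_simps)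
  then have "p * s = r * q" using of_nat_eq_iff by blast
  then have "p = r \<and> s = q" using assms coprime_crossproduct_nat[of p q r s]
    by (simp add: ac_simps)
  then show "p = r" "q = s" by auto
qed

text \<open>A Farey pair is a pair of row neighbours. Lowest terms identify numerators and
  denominators, so the mediant is the odd entry between them in the next row.\<close>

lemma is_question_mark_stern_sup: "is_question_mark stern_sup"
  unfolding is_question_mark_def
proof (intro conjI allI impI stern_sup_continuous stern_sup_mono)
  show "stern_sup 0 = 0" using stern_sup_stern[of 0 0] by (simp add: stern_def)
  show "stern_sup 1 = 1" using stern_sup_stern[of 1 0] by (simp add: stern_def)
next
  fix p q p' q' :: nat
  assume *: "0 < q \<and> 0 < q' \<and> coprime p q \<and> coprime p' q' \<and>
        farey_consecutive (real p / real q) (real p' / real q')"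
  then obtain n k where nk: "k < 2 ^ n" "real p / real q = stern n k" "real p' / real q' = stern n (Suc k)"
    using farey_consecutive_stern by blast
  have cop: "coprime p q" "coprime p' q'" and pos: "0 < q" "0 < q'" using * by auto
  note unique = coprime_fraction_unique[OF _ _ stern_coprime _ stern_den_pos, folded stern_def]
  note eq = unique[OF nk(2) cop(1) pos(1)] unique[OF nk(3) cop(2) pos(2)]
  show "stern_sup (real (p + p') / real (q + q')) =
      (stern_sup (real p / real q) + stern_sup (real p' / real q')) / 2"
    unfolding nk(2,3) unfolding eq stern_mediant
    using nk(1) stern_sup_stern[of k n] stern_sup_stern[of "Suc k" n] stern_sup_stern[of "Suc (2 * k)" "Suc n"]
    by (simp add: add_divide_distrib)
qed (auto simp: stern_sup_def)

lemma is_question_mark_question_mark: "is_question_mark question_mark"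
  unfolding question_mark_def
  by (metis is_question_mark_stern_sup is_question_mark_unique theI)

lemma question_mark_mono:
  "0 \<le> x \<Longrightarrow> x \<le> y \<Longrightarrow> y \<le> 1 \<Longrightarrow> question_mark x \<le> question_mark y"
  using is_question_mark_question_mark unfolding is_question_mark_def mono_on_def by auto

section \<open>Edges of the tree and the slopes of \<open>?\<close>\<close>

text \<open>Either fraction may be the left one, since successive convergents alternate around their
  limit.\<close>

definition stern_edge :: "nat \<Rightarrow> nat \<Rightarrow> nat \<Rightarrow> nat \<Rightarrow> nat \<Rightarrow> bool" where
  "stern_edge n p q p' q' \<longleftrightarrow> (\<exists>k<2 ^ n.
     (p = stern_num n k \<and> q = stern_den n k \<and> p' = stern_num n (Suc k) \<and> q' = stern_den n (Suc k)) \<or>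
     (p' = stern_num n k \<and> q' = stern_den n k \<and> p = stern_num n (Suc k) \<and> q = stern_den n (Suc k)))"

lemma stern_edge_0: "stern_edge 0 0 1 1 1"
  unfolding stern_edge_def by simp

lemma stern_edge_swap: "stern_edge n p q p' q' \<Longrightarrow> stern_edge n p' q' p q"
  unfolding stern_edge_def by blast

lemma stern_edge_mediant: 
  assumes "stern_edge n p q p' q'"
  shows "stern_edge (Suc n) p q (p + p') (q + q')"
proof -
  obtain k where k: "k < 2 ^ n"
     "(p = stern_num n k \<and> q = stern_den n k \<and> p' = stern_num n (Suc k) \<and> q' = stern_den n (Suc k)) \<or>
     (p' = stern_num n k \<and> q' = stern_den n k \<and> p = stern_num n (Suc k) \<and> q = stern_den n (Suc k))"
    using assms unfolding stern_edge_def by blast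
  then show ?thesis
  proof (elim disjE)
    assume "p = stern_num n k \<and> q = stern_den n k \<and> p' = stern_num n (Suc k) \<and> q' = stern_den n (Suc k)"
    then show ?thesis unfolding stern_edge_def using k(1)
      by (intro exI[of _ "2 * k"]) simp
  next
    assume "p' = stern_num n k \<and> q' = stern_den n k \<and> p = stern_num n (Suc k) \<and> q = stern_den n (Suc k)"
    then show ?thesis unfolding stern_edge_def using k(1)
      by (intro exI[of _ "Suc (2 * k)"]) simp
  qed
qed

text \<open>Repeated mediants with \<open>p / q\<close> fixed; for convergents these are the
  intermediate fractions.\<close>

lemma stern_edge_run:
  assumes "stern_edge n p q p' q'"
  shows "stern_edge (n + i) p q (p' + i * p) (q' + i * q)"
proof (induction i)
  case (Suc i)
  from stern_edge_mediant[OF this] show ?case by (simp add: algebra_simps)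
qed (use assms in simp)

text \<open>The sign \<open>e\<close> records the orientation: it is 1 if \<open>p / q\<close> is
  the left end and -1 otherwise.\<close>

lemma stern_edge_props:
  assumes "stern_edge n p q p' q'"
  defines "e \<equiv> real p' * real q - real p * real q'"
  shows "e = 1 \<or> e = -1" and "0 < q" and "0 < q'"
    and "question_mark (real p' / real q') - question_mark (real p / real q) = e / 2 ^ n"
    and "real p / real q \<in> {0..1}" and "real p' / real q' \<in> {0..1}"
proof -
  obtain k where k: "k < 2 ^ n"
     "(p = stern_num n k \<and> q = stern_den n k \<and> p' = stern_num n (Suc k) \<and> q' = stern_den n (Suc k)) \<or>
     (p' = stern_num n k \<and> q' = stern_den n k \<and> p = stern_num n (Suc k) \<and> q = stern_den n (Suc k))"
    using assms unfolding stern_edge_def by blast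
  have uni: "real (stern_num n (Suc k)) * real (stern_den n k)
      = real (stern_num n k) * real (stern_den n (Suc k)) + 1"
    using stern_unimodular[of n k] by (metis of_nat_1 of_nat_add of_nat_mult)
  have qm: "question_mark (real (stern_num n k) / real (stern_den n k)) = real k / 2 ^ n"
     "question_mark (real (stern_num n (Suc k)) / real (stern_den n (Suc k))) = real (Suc k) / 2 ^ n"
    using is_question_mark_stern[OF is_question_mark_question_mark, of k n]
      is_question_mark_stern[OF is_question_mark_question_mark, of "Suc k" n] k(1)
    unfolding stern_def by simp_all
  show "e = 1 \<or> e = -1" using k(2) uni unfolding e_def by (auto simp: algebra_simps)
  show "0 < q" "0 < q'" using k(2) stern_den_pos by auto
  show "question_mark (real p' / real q') - question_mark (real p / real q) = e / 2 ^ n"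
    using k(2) uni qm unfolding e_def by (auto simp: algebra_simps add_divide_distrib diff_divide_distrib)
  show "real p / real q \<in> {0..1}" "real p' / real q' \<in> {0..1}"
    using k stern_unit[of k n] stern_unit[of "Suc k" n] unfolding stern_def by auto
qed

section \<open>Difference quotients beyond a mediant\<close>

lemma stern_edge_signed:
  assumes "stern_edge n p q p' q'" and e: "e = real p' * real q - real p * real q'"
  shows "e * e = 1" and "e * (real p' / real q' - real p / real q) = 1 / (real q * real q')"
    and "e * (question_mark (real p' / real q') - question_mark (real p / real q)) = 1 / 2 ^ n"
proof -
  note props = stern_edge_props[OF assms(1), folded e]
  show ee: "e * e = 1" using props(1) by auto
  have "real p' / real q' - real p / real q = e / (real q * real q')"
    using props(2,3) unfolding e by (simp add: field_simps)
  then show "e * (real p' / real q' - real p / real q) = 1 / (real q * real q')" using ee by simp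
  show "e * (question_mark (real p' / real q') - question_mark (real p / real q)) = 1 / 2 ^ n"
    using props(4) ee by simp
qed

lemma question_mark_mono_signed:
  assumes "e = 1 \<or> e = -1" "e * x \<le> e * y" "x \<in> {0..1}" "y \<in> {0..1}"
  shows "e * question_mark x \<le> e * question_mark y"
  using assms question_mark_mono[of x y] question_mark_mono[of y x] by auto

lemma inverse_mult_mono:
  assumes "0 < (a::real)" "0 < b" "b \<le> c"
  shows "1 / (a * c) \<le> 1 / (a * b)"
  using assms by (intro divide_left_mono) auto

text \<open>The quotient is estimated separately between \<open>x\<close> and the mediant \<open>P/Q\<close>, where \<open>x\<close> lies between
  two consecutive points of the run \<open>(p + i P)/(q + i Q)\<close>, and between \<open>P/Q\<close> and \<open>y\<close>, using the
  mirrored run \<open>(p' + i P)/(q' + i Q)\<close>, which has comparable denominators. The sign \<open>e\<close> covers both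
  orientations. Beyond index \<open>j\<close> of the mirrored run no slope is available, but there \<open>y\<close> is as
  close to \<open>P/Q\<close> as \<open>x\<close> is.\<close>

lemma question_mark_quotient_lower:
  fixes n p q p' q' j :: nat and x y z M :: real
  assumes edge: "stern_edge n p q p' q'"
  defines "P \<equiv> p + p'" and "Q \<equiv> q + q'" and "e \<equiv> real p' * real q - real p * real q'"
  assumes x: "x = (real p + z * real P) / (real q + z * real Q)"
    and z: "0 < z" "real j \<le> z" "z < real j + 1"
    and y: "e * (real P / real Q) \<le> e * y" "e * y \<le> e * (real p' / real q')"
    and M: "0 \<le> M" "M \<le> real q * real q' / 2 ^ n"
      "\<And>i. 1 \<le> i \<Longrightarrow> i \<le> j \<Longrightarrow> M \<le> real Q * (real q + real i * real Q) / 2 ^ (n + 1 + i)"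
  shows "M / 8 \<le> (question_mark y - question_mark x) / (y - x)"
proof -
  note props = stern_edge_props[OF edge, folded e_def]
  note e = props(1)
  have pos: "0 < real q" "0 < real q'" "0 < real Q" using props(2,3) by (auto simp: Q_def)
  have PQ: "real P = real p + real p'" "real Q = real q + real q'" by (simp_all add: P_def Q_def)
  \<comment> \<open>The mediant is the fixed end of both runs: \<open>edge1\<close> leads to the
    side of \<open>x\<close>, \<open>edge2\<close> to that of \<open>y\<close>.\<close>
  have edge1: "stern_edge (n + 1) P Q p q"
    using stern_edge_swap[OF stern_edge_mediant[OF edge]] by (simp add: P_def Q_def)
  have edge2: "stern_edge (n + 1) P Q p' q'"
    using stern_edge_swap[OF stern_edge_mediant[OF stern_edge_swap[OF edge]]]
    by (simp add: P_def Q_def add.commute)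
  have flip: "- e * (a - b) = e * (b - a)" for a b by (simp add: algebra_simps)
  have near: "e * (real P / real Q - real (p + i * P) / real (q + i * Q)) = 1 / (real Q * (real q + real i * real Q))"
       "e * (question_mark (real P / real Q) - question_mark (real (p + i * P) / real (q + i * Q))) = 1 / 2 ^ (n + 1 + i)"
       "real (p + i * P) / real (q + i * Q) \<in> {0..1}" for i
  proof -
    have "- e = real (p + i * P) * real Q - real P * real (q + i * Q)"
      unfolding e_def by (simp add: PQ algebra_simps)
    from stern_edge_signed(2,3)[OF stern_edge_run[OF edge1, of i] this]
    show "e * (real P / real Q - real (p + i * P) / real (q + i * Q)) = 1 / (real Q * (real q + real i * real Q))"
       "e * (question_mark (real P / real Q) - question_mark (real (p + i * P) / real (q + i * Q))) = 1 / 2 ^ (n + 1 + i)"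
      by (simp_all only: flip of_nat_add of_nat_mult)
    show "real (p + i * P) / real (q + i * Q) \<in> {0..1}"
      using stern_edge_props(6)[OF stern_edge_run[OF edge1, of i]] .
  qed
  have far: "e * (real (p' + i * P) / real (q' + i * Q) - real P / real Q) = 1 / (real Q * (real q' + real i * real Q))"
       "e * (question_mark (real (p' + i * P) / real (q' + i * Q)) - question_mark (real P / real Q)) = 1 / 2 ^ (n + 1 + i)"
       "real (p' + i * P) / real (q' + i * Q) \<in> {0..1}" for i
  proof -
    have "e = real (p' + i * P) * real Q - real P * real (q' + i * Q)"
      unfolding e_def by (simp add: PQ algebra_simps)
    from stern_edge_signed(2,3)[OF stern_edge_run[OF edge2, of i] this]
    show "e * (real (p' + i * P) / real (q' + i * Q) - real P / real Q) = 1 / (real Q * (real q' + real i * real Q))"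
       "e * (question_mark (real (p' + i * P) / real (q' + i * Q)) - question_mark (real P / real Q)) = 1 / 2 ^ (n + 1 + i)"
      by (simp_all only: of_nat_add of_nat_mult)
    show "real (p' + i * P) / real (q' + i * Q) \<in> {0..1}"
      using stern_edge_props(6)[OF stern_edge_run[OF edge2, of i]] .
  qed
  have unitP: "real P / real Q \<in> {0..1}" using stern_edge_props(5)[OF edge1] .
  have unity: "y \<in> {0..1}"
    using e
  proof
    assume "e = 1"
    with y have "real P / real Q \<le> y" "y \<le> real p' / real q'" by simp_all
    with unitP props(6) show ?thesis unfolding atLeastAtMost_iff by linarith
  next
    assume "e = -1"
    with y have "y \<le> real P / real Q" "real p' / real q' \<le> y" by simp_all
    with unitP props(6) show ?thesis unfolding atLeastAtMost_iff by linarith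
  qed
  have pz: "0 < real q + z * real Q" using pos z(1) by (simp add: add_pos_pos)
  \<comment> \<open>\<open>u\<close> and \<open>v\<close> are the distances of \<open>x\<close> and
    \<open>y\<close> from the mediant; \<open>U\<close> and \<open>V\<close> below are the
    corresponding increments of \<open>?\<close>.\<close>
  define u where "u = e * (real P / real Q - x)"
  define v where "v = e * (y - real P / real Q)"
  have u_eq: "u = 1 / (real Q * (real q + z * real Q))"
  proof -
    have "real P / real Q - x = (real P * real q - real p * real Q) / (real Q * (real q + z * real Q))"
      unfolding x using pos(3) pz by (simp add: field_simps)
    also have "real P * real q - real p * real Q = e" unfolding e_def by (simp add: PQ algebra_simps)
    finally show ?thesis unfolding u_def using e by auto
  qed
  have u0: "0 < u" unfolding u_eq using pos pz by simp
  have v0: "0 \<le> v" unfolding v_def using y(1) by (simp add: algebra_simps)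
  have u_le: "u \<le> 1 / (real Q * (real q + real i * real Q))" if "real i \<le> z" for i
    unfolding u_eq using that pos by (intro inverse_mult_mono) (auto intro!: mult_right_mono add_pos_nonneg)
  have u_ge: "1 / (real Q * (real q + real (Suc j) * real Q)) \<le> u"
    unfolding u_eq using z pos pz by (intro inverse_mult_mono) (auto intro!: mult_right_mono)
  have unitx: "x \<in> {0..1}"
  proof -
    have "e * (real p / real q) \<le> e * x"
      using u_le[of 0] near(1)[of 0] z u_def by (simp add: algebra_simps)
    moreover have "e * x \<le> e * (real P / real Q)" using u0 u_def by (simp add: algebra_simps)
    ultimately have "e = 1 \<and> real p / real q \<le> x \<and> x \<le> real P / real Q \<or>
        real P / real Q \<le> x \<and> x \<le> real p / real q"
      using e by auto
    with unitP props(5) show ?thesis unfolding atLeastAtMost_iff by linarith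
  qed
  define U where "U = e * (question_mark (real P / real Q) - question_mark x)"
  define V where "V = e * (question_mark y - question_mark (real P / real Q))"
  \<comment> \<open>Since z < j + 1, \<open>x\<close> is farther from \<open>P / Q\<close> than
    point j + 1 of the run, so \<open>U\<close> is at least the increment over that edge.\<close>
  have U_ge: "1 / 2 ^ (n + j + 2) \<le> U"
  proof -
    have "e * x \<le> e * (real (p + Suc j * P) / real (q + Suc j * Q))"
      using u_ge near(1)[of "Suc j"] unfolding u_def right_diff_distrib by linarith
    from question_mark_mono_signed[OF e this unitx near(3)] near(2)[of "Suc j"]
    show ?thesis unfolding U_def right_diff_distrib by (simp add: algebra_simps)
  qed
  have V0: "0 \<le> V"
    using question_mark_mono_signed[OF e y(1) unitP unity] unfolding V_def by (simp add: algebra_simps)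
  have v_le: "v \<le> 1 / (real Q * real q')"
    using far(1)[of 0] y(2) unfolding v_def by (simp add: algebra_simps)
  \<comment> \<open>For i \<ge> 1 both q + iQ and q' + iQ lie between iQ and (i + 1)Q, so they
    differ by a factor of at most 2. For i = 0 they are not comparable, and the slope of the
    original edge is used instead.\<close>
  have far_le: "1 / (real Q * (real q' + real i * real Q)) \<le> 2 / (real Q * (real q + real i * real Q))"
    if "1 \<le> i" for i
  proof -
    have "1 * real Q \<le> real i * real Q" using that by (intro mult_right_mono) auto
    moreover have "real q \<le> real Q" using PQ(2) by simp
    ultimately have "real q \<le> real i * real Q" by simp
    then have "real q + real i * real Q \<le> 2 * (real q' + real i * real Q)" using pos by (simp add: mult.commute)
    moreover have "0 < real q + real i * real Q" using pos by (simp add: add_pos_nonneg)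
    moreover have "0 < real q' + real i * real Q" using pos by (simp add: add_pos_nonneg)
    ultimately show ?thesis using pos by (simp add: divide_simps) 
  qed
  have M_near: "M * (1 / (real Q * (real q + real i * real Q))) \<le> 1 / 2 ^ (n + 1 + i)"
    if "1 \<le> i" "i \<le> j" for i
  proof -
    have "0 < real Q * (real q + real i * real Q)" using pos by (simp add: add_pos_nonneg)
    then show ?thesis using M(3)[OF that] by (simp add: field_simps)
  qed
  have M_0: "M * (1 / (real q * real q')) \<le> 1 / 2 ^ n"
    using M(2) pos by (simp add: field_simps)
  \<comment> \<open>The cases below lose a factor of at most 6, which 8 covers.\<close>
  have main: "M / 8 * (u + v) \<le> U + V"
  proof (cases "v \<le> 1 / (real Q * (real q' + real j * real Q))")
    case True
    have "M / 8 * (u + v) \<le> 1 / 2 ^ (n + j + 2)"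
    proof (cases "j = 0")
      case j: True
      \<comment> \<open>The two halves of the original edge add up to its full length.\<close>
      have "1 / (real Q * real q) + 1 / (real Q * real q') = 1 / (real q * real q')"
        using pos PQ(2) by (simp add: divide_simps)
      then have "u + v \<le> 1 / (real q * real q')" using u_le[of 0] True j z by simp
      then have "M * (u + v) \<le> M * (1 / (real q * real q'))" using M(1) by (rule mult_left_mono)
      with M_0 have "M * (u + v) \<le> 1 / 2 ^ n" by linarith
      moreover have "0 \<le> 1 / (2::real) ^ n" by simp
      ultimately show ?thesis using j by (simp add: divide_simps)
    next
      case False
      then have "u + v \<le> 3 * (1 / (real Q * (real q + real j * real Q)))"
        using u_le[of j] True z far_le[of j] by simp
      then have "M * (u + v) \<le> M * (3 * (1 / (real Q * (real q + real j * real Q))))"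
        using M(1) by (rule mult_left_mono)
      with M_near[of j] False have "M * (u + v) \<le> 3 * (1 / 2 ^ (n + 1 + j))" by simp
      moreover have "1 / (2::real) ^ (n + j + 2) = 1 / 2 * (1 / 2 ^ (n + 1 + j))" by simp
      moreover have "0 \<le> 1 / (2::real) ^ (n + 1 + j)" by simp
      ultimately show ?thesis by linarith
    qed
    then show ?thesis using U_ge V0 by linarith
  next
    case False
    let ?B = "\<lambda>i. 1 / (real Q * (real q' + real i * real Q)) < v"
    \<comment> \<open>Point \<open>k\<close> is the first of the mirrored run that is closer to the
      mediant than \<open>y\<close>. Thus \<open>y\<close> lies between points k - 1 and k, and
      \<open>V\<close> covers the edge from the mediant to point \<open>k\<close>.\<close>
    define k where "k = (LEAST i. ?B i)"
    have k1: "?B k" unfolding k_def using False by (intro LeastI[of ?B j]) simp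
    have kj: "k \<le> j" unfolding k_def using False by (intro Least_le) simp
    have "k \<noteq> 0"
    proof
      assume "k = 0"
      with k1 v_le show False by simp
    qed
    then obtain i where i: "k = Suc i" using not0_implies_Suc by blast
    have v_i: "v \<le> 1 / (real Q * (real q' + real i * real Q))"
      using not_less_Least[of i ?B] i unfolding k_def by (simp add: not_less)
    have "e * (real (p' + k * P) / real (q' + k * Q)) \<le> e * y"
      using k1 far(1)[of k] unfolding v_def right_diff_distrib by linarith
    from question_mark_mono_signed[OF e this far(3) unity] far(2)[of k]
    have V_ge: "1 / 2 ^ (n + 2 + i) \<le> V" unfolding V_def right_diff_distrib by (simp add: i)
    have "M / 8 * v \<le> 1 / 2 ^ (n + 2 + i)"
    proof (cases "i = 0")
      case True
      have "v \<le> 1 / (real q * real q')" 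
        using v_le inverse_mult_mono[of "real q'" "real q" "real Q"] pos PQ(2) by (simp add: mult.commute)
      then have "M * v \<le> M * (1 / (real q * real q'))" using M(1) by (rule mult_left_mono)
      with M_0 have "M * v \<le> 1 / 2 ^ n" by linarith
      moreover have "0 \<le> 1 / (2::real) ^ n" by simp
      ultimately show ?thesis using True by (simp add: divide_simps)
    next
      case False
      then have "v \<le> 2 * (1 / (real Q * (real q + real i * real Q)))" using v_i far_le[of i] by simp
      then have "M * v \<le> M * (2 * (1 / (real Q * (real q + real i * real Q))))"
        using M(1) by (rule mult_left_mono)
      also have "\<dots> = 2 * (M * (1 / (real Q * (real q + real i * real Q))))" by simp
      also have "\<dots> \<le> 2 * (1 / 2 ^ (n + 1 + i))"
        using M_near[of i] False i kj by (intro mult_left_mono) auto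
      finally have "M * v \<le> 2 * (1 / 2 ^ (n + 1 + i))" .
      moreover have "1 / (2::real) ^ (n + 2 + i) = 1 / 2 * (1 / 2 ^ (n + 1 + i))" by simp
      moreover have "0 \<le> 1 / (2::real) ^ (n + 1 + i)" by simp
      ultimately show ?thesis by linarith
    qed
    moreover have "M / 8 * u \<le> 1 / 2 ^ (n + j + 2)"
    proof -
      have "M * u \<le> M * (1 / (real Q * (real q + real j * real Q)))"
        using u_le[of j] z M(1) by (intro mult_left_mono) auto
      with M_near[of j] i kj have "M * u \<le> 1 / 2 ^ (n + 1 + j)" by simp
      moreover have "1 / (2::real) ^ (n + j + 2) = 1 / 2 * (1 / 2 ^ (n + 1 + j))" by simp
      moreover have "0 \<le> 1 / (2::real) ^ (n + 1 + j)" by simp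
      ultimately show ?thesis by linarith
    qed
    ultimately show ?thesis using U_ge V_ge by (simp add: distrib_left)
  qed
  have "u + v = e * (y - x)" "U + V = e * (question_mark y - question_mark x)"
    unfolding u_def v_def U_def V_def by (simp_all add: algebra_simps)
  moreover have "0 < u + v" using u0 v0 by simp
  ultimately have "M / 8 \<le> (e * (question_mark y - question_mark x)) / (e * (y - x))"
    using main by (metis pos_le_divide_eq)
  also have "\<dots> = (question_mark y - question_mark x) / (y - x)" using e by auto
  finally show ?thesis .
qed

section \<open>Convergents of a continued fraction\<close>

text \<open>Indices are shifted by one: \<open>conv_num a (Suc t) / conv_den a (Suc t)\<close> is the convergent
  \<open>p\<^sub>t / q\<^sub>t\<close>, and index 0 carries \<open>p\<^sub>-\<^sub>1 = 1\<close>, \<open>q\<^sub>-\<^sub>1 = 0\<close>.\<close>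

fun conv_num :: "(nat \<Rightarrow> nat) \<Rightarrow> nat \<Rightarrow> nat" where
  "conv_num a 0 = 1"
| "conv_num a (Suc 0) = 0"
| "conv_num a (Suc (Suc t)) = a (Suc t) * conv_num a (Suc t) + conv_num a t"

fun conv_den :: "(nat \<Rightarrow> nat) \<Rightarrow> nat \<Rightarrow> nat" where
  "conv_den a 0 = 0"
| "conv_den a (Suc 0) = 1"
| "conv_den a (Suc (Suc t)) = a (Suc t) * conv_den a (Suc t) + conv_den a t"

section \<open>Convergents as edges of the tree\<close>

text \<open>\<open>y t\<close> is the tail [0; a_(t+1), a_(t+2), ...]. The locale serves both for
  the expansion of a given number and for a number built from prescribed quotients.\<close>

locale cf_expansion =
  fixes x :: real and a :: "nat \<Rightarrow> nat" and y :: "nat \<Rightarrow> real"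
  assumes y_0: "y 0 = x" and y_pos: "0 < y t" and y_less_1: "y t < 1"
    and y_eq: "y t = 1 / (real (a (Suc t)) + y (Suc t))"
begin

abbreviation "N \<equiv> conv_num a"
abbreviation "D \<equiv> conv_den a"
abbreviation "S t \<equiv> (\<Sum>i = 1..t. a i)"

lemma a_pos: "1 \<le> a (Suc t)"
proof (rule ccontr)
  assume "\<not> 1 \<le> a (Suc t)"
  then have "y t = 1 / y (Suc t)" using y_eq[of t] by (cases "a (Suc t)") auto
  moreover have "1 < 1 / y (Suc t)" using y_less_1[of "Suc t"] y_pos[of "Suc t"] by simp
  ultimately show False using y_less_1[of t] by simp
qed

lemma y_inverse: "1 / y t = real (a (Suc t)) + y (Suc t)"
  by (subst y_eq) simp

lemma D_mono_Suc: "D t \<le> D (Suc t)"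
proof (cases t)
  case (Suc s)
  have "1 * D (Suc s) \<le> a (Suc s) * D (Suc s)" using a_pos[of s] by (rule mult_le_mono1)
  then show ?thesis unfolding Suc conv_den.simps(3) by linarith
qed simp

lemma D_pos: "0 < D (Suc t)"
proof (induction t)
  case (Suc t)
  then show ?case using D_mono_Suc[of "Suc t"] by linarith
qed simp

lemma S_ge: "t \<le> S t"
proof (induction t)
  case (Suc t)
  then show ?case using a_pos[of t] by simp
qed simp

text \<open>The run with i = a_(t+1) ends at the next convergent; swapping the ends makes that
  convergent the fixed end of the following run.\<close>

lemma convergent_edge:
  assumes "1 \<le> t"
  shows "stern_edge (S t - 1 + i) (N (Suc t)) (D (Suc t)) (N t + i * N (Suc t)) (D t + i * D (Suc t))"
  using assms
proof (induction t arbitrary: i rule: dec_induct)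
  case base
  \<comment> \<open>The formal convergent 1/0 is outside the unit interval, so the first run starts
    at 1/1 and has one step fewer. This causes the level \<open>S t - 1\<close>.\<close>
  have "stern_edge (0 + (a 1 - 1)) 0 1 (1 + (a 1 - 1) * 0) (1 + (a 1 - 1) * 1)"
    by (rule stern_edge_run[OF stern_edge_0])
  then have "stern_edge (S 1 - 1) (N (Suc 1)) (D (Suc 1)) (N 1) (D 1)"
    using a_pos[of 0] by - (rule stern_edge_swap, simp)
  then show ?case by (rule stern_edge_run)
next
  case (step t)
  have "S t \<ge> 1" using S_ge[of t] step.hyps by simp
  then have "S t - 1 + a (Suc t) = S (Suc t) - 1" by simp
  with step.IH[of "a (Suc t)"]
  have "stern_edge (S (Suc t) - 1) (N (Suc (Suc t))) (D (Suc (Suc t))) (N (Suc t)) (D (Suc t))"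
    by - (rule stern_edge_swap, simp add: add.commute)
  then show ?case by (rule stern_edge_run)
qed

text \<open>For t \<ge> 1 this is the sign of \<open>N t / D t - x\<close>, by
  \<open>convergent_diff\<close>.\<close>

definition side :: "nat \<Rightarrow> real" where
  "side t = real (N t) * real (D (Suc t)) - real (N (Suc t)) * real (D t)"

lemma side_Suc: "side (Suc t) = - side t"
  unfolding side_def by (simp add: algebra_simps)

lemma side_cases: "side t = 1 \<or> side t = -1"
  by (induction t) (auto simp: side_def[of 0] side_Suc)

lemma x_eq: "x = (real (N (Suc t)) + y t * real (N t)) / (real (D (Suc t)) + y t * real (D t))"
proof (induction t)
  case 0
  show ?case by (simp add: y_0)
next
  case (Suc t)
  have pos: "0 < real (a (Suc t)) + y (Suc t)" using y_pos[of "Suc t"] by simp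
  show ?case unfolding Suc y_eq[of t] using pos
    by (simp add: divide_simps) (simp add: algebra_simps)
qed

lemma den_pos: "0 < real (D (Suc t)) + y t * real (D t)"
  using D_pos[of t] y_pos[of t] by (simp add: add_pos_nonneg)

lemma convergent_diff:
  assumes "1 \<le> t"
  shows "side t * (real (N t) / real (D t) - x) = 1 / (real (D t) * (real (D (Suc t)) + y t * real (D t)))"
proof -
  obtain s where s: "t = Suc s" using assms by (cases t) auto
  have "real (N t) / real (D t) - x = side t / (real (D t) * (real (D (Suc t)) + y t * real (D t)))"
    unfolding side_def using D_pos[of s] den_pos[of t] s
    by (subst x_eq[of t]) (simp add: divide_simps, simp add: algebra_simps)
  then show ?thesis using side_cases[of t] by auto
qed

lemma D_ge: "t \<le> D (Suc t)"
proof (induction t rule: induct_nat_012)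
  case (ge2 n)
  have "1 * D (Suc (Suc n)) \<le> a (Suc (Suc n)) * D (Suc (Suc n))" using a_pos by (rule mult_le_mono1)
  then show ?case using ge2 D_pos[of n] unfolding conv_den.simps(3)[of a "Suc n"] by linarith
qed (use a_pos[of 0] in auto)

lemma convergent_dist_tendsto: "(\<lambda>t. side (Suc t) * (real (N (Suc t)) / real (D (Suc t)) - x)) \<longlonglongrightarrow> 0"
proof (rule real_tendsto_sandwich[where f = "\<lambda>_. 0" and h = "\<lambda>t. 1 / real t"])
  show "(\<lambda>t. 1 / real t) \<longlonglongrightarrow> 0" by (rule lim_1_over_n)
  show "\<forall>\<^sub>F t in sequentially. 0 \<le> side (Suc t) * (real (N (Suc t)) / real (D (Suc t)) - x)"
  proof (intro always_eventually allI)
    fix t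
    show "0 \<le> side (Suc t) * (real (N (Suc t)) / real (D (Suc t)) - x)"
      using den_pos[of "Suc t"] by (subst convergent_diff) (simp_all del: conv_den.simps)
  qed
  show "\<forall>\<^sub>F t in sequentially. side (Suc t) * (real (N (Suc t)) / real (D (Suc t)) - x) \<le> 1 / real t"
  proof (rule eventually_sequentiallyI[of 1])
    fix t :: nat assume t: "1 \<le> t"
    have "real t * 1 \<le> real (D (Suc t)) * (real (D (Suc (Suc t))) + y (Suc t) * real (D (Suc t)))"
    proof (intro mult_mono)
      show "real t \<le> real (D (Suc t))" using D_ge by simp
      have "1 \<le> real (D (Suc (Suc t)))" using D_pos[of "Suc t"] by linarith
      then show "1 \<le> real (D (Suc (Suc t))) + y (Suc t) * real (D (Suc t))"
        using y_pos[of "Suc t"] by (simp add: add_increasing2)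
    qed auto
    then show "side (Suc t) * (real (N (Suc t)) / real (D (Suc t)) - x) \<le> 1 / real t"
      using t by (subst convergent_diff) (auto intro!: divide_left_mono mult_pos_pos den_pos simp: D_pos simp del: conv_den.simps)
  qed
qed simp

section \<open>Lower bounds for the difference quotients at \<open>x\<close>\<close>

text \<open>Half the slope of \<open>?\<close> between \<open>p\<^sub>t / q\<^sub>t\<close> and the \<open>i\<close>-th intermediate fraction; the level of this
  edge is \<open>S t - 1 + i\<close>, and the factor 2 avoids the truncated subtraction.\<close>

definition slope :: "nat \<Rightarrow> nat \<Rightarrow> real" where
  "slope t i = real (D (Suc t)) * (real (D t) + real i * real (D (Suc t))) / 2 ^ (S t + i)"

lemma quotient_lower_local:
  assumes t: "1 \<le> t" and i: "i < a (Suc t)" and M: "0 \<le> M" "M \<le> 2 * slope t i"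
    and M': "\<And>k. 1 \<le> k \<Longrightarrow> k \<le> a (Suc (Suc t)) \<Longrightarrow> M \<le> 2 * slope (Suc t) k"
    and v: "side t * (real (N t + Suc i * N (Suc t)) / real (D t + Suc i * D (Suc t))) \<le> side t * v"
      "side t * v \<le> side t * (real (N t + i * N (Suc t)) / real (D t + i * D (Suc t)))"
  shows "M / 8 \<le> (question_mark v - question_mark x) / (v - x)"
proof -
  let ?p = "N (Suc t)" and ?q = "D (Suc t)" and ?p' = "N t + i * N (Suc t)" and ?q' = "D t + i * D (Suc t)"
  have St: "S t \<ge> 1" using S_ge[of t] t by simp
  \<comment> \<open>Chosen so that \<open>x\<close> is the point with real parameter
    \<open>1 / w\<close> on the run from the convergent \<open>N (Suc t) / D (Suc t)\<close> towards
    intermediate fraction i + 1.\<close>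
  define w where "w = real (a (Suc t)) - real (Suc i) + y (Suc t)"
  have w: "0 < w" using i y_pos[of "Suc t"] unfolding w_def by linarith
  \<comment> \<open>This is the integer part of \<open>1 / w\<close>. Before the end of the run w >
    1. At its end the mediant is the next convergent and w = y (t + 1), with a_(t+2) as the integer
    part of the inverse.\<close>
  define j where "j = (if Suc i = a (Suc t) then a (Suc (Suc t)) else 0)"
  have j: "real j \<le> 1 / w" "1 / w < real j + 1"
  proof -
    have "real j \<le> 1 / w \<and> 1 / w < real j + 1"
    proof (cases "Suc i = a (Suc t)")
      case True
      then have "w = y (Suc t)" unfolding w_def by simp
      then show ?thesis using True y_inverse[of "Suc t"] y_pos[of "Suc (Suc t)"] y_less_1[of "Suc (Suc t)"]
        unfolding j_def by simp
    next
      case False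
      then have "real (Suc i) + 1 \<le> real (a (Suc t))" using i by linarith
      then have "1 < w" unfolding w_def using y_pos[of "Suc t"] by linarith
      then show ?thesis using False unfolding j_def by simp
    qed
    then show "real j \<le> 1 / w" "1 / w < real j + 1" by auto
  qed
  have PQ: "?p + ?p' = N t + Suc i * N (Suc t)" "?q + ?q' = D t + Suc i * D (Suc t)" by simp_all
  have e: "real ?p' * real ?q - real ?p * real ?q' = side t"
    unfolding side_def by (simp add: algebra_simps)
  have x: "x = (real ?p + 1 / w * real (?p + ?p')) / (real ?q + 1 / w * real (?q + ?q'))"
  proof -
    have yt: "1 / y t = w + real (Suc i)" unfolding y_inverse w_def by simp
    have "x = (real ?p + y t * real (N t)) / (real ?q + y t * real (D t))" by (rule x_eq)
    also have "\<dots> = (1 / y t * (real ?p + y t * real (N t))) / (1 / y t * (real ?q + y t * real (D t)))"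
      using y_pos[of t] by simp
    also have "1 / y t * (real ?p + y t * real (N t)) = 1 / y t * real ?p + real (N t)"
      using y_pos[of t] by (simp add: field_simps)
    also have "\<dots> = w * (real ?p + 1 / w * real (?p + ?p'))"
      unfolding yt using w by (simp add: field_simps)
    also have "1 / y t * (real ?q + y t * real (D t)) = 1 / y t * real ?q + real (D t)"
      using y_pos[of t] by (simp add: field_simps)
    also have "\<dots> = w * (real ?q + 1 / w * real (?q + ?q'))"
      unfolding yt using w by (simp add: field_simps)
    finally show ?thesis using w by simp
  qed
  show ?thesis
  proof (rule question_mark_quotient_lower[OF convergent_edge[OF t, of i] x _ j])
    show "0 < 1 / w" using w by simp
    show "0 \<le> M" by (rule M(1))
    show "(real ?p' * real ?q - real ?p * real ?q') * (real (?p + ?p') / real (?q + ?q'))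
       \<le> (real ?p' * real ?q - real ?p * real ?q') * v"
      unfolding e PQ by (rule v(1))
    show "(real ?p' * real ?q - real ?p * real ?q') * v
      \<le> (real ?p' * real ?q - real ?p * real ?q') * (real ?p' / real ?q')"
      unfolding e by (rule v(2))
    have "S t + i = Suc (S t - 1 + i)" using St by simp
    then show "M \<le> real ?q * real ?q' / 2 ^ (S t - 1 + i)"
      using M(2) unfolding slope_def by (simp only: power_Suc) (simp add: field_simps)
  next
    fix k assume k: "1 \<le> k" "k \<le> j"
    then have i_eq: "Suc i = a (Suc t)" and "k \<le> a (Suc (Suc t))" unfolding j_def by (auto split: if_splits)
    from M'[OF k(1) this(2)]
    have M_le: "M \<le> 2 * slope (Suc t) k" .
    have D_eq: "?q + ?q' = D (Suc (Suc t))" using i_eq by (simp flip: i_eq)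
    have S_eq: "S (Suc t) + k = Suc (S t - 1 + i + 1 + k)" using St by (simp flip: i_eq)
    show "M \<le> real (?q + ?q') * (real ?q + real k * real (?q + ?q')) / 2 ^ (S t - 1 + i + 1 + k)"
      using M_le unfolding slope_def S_eq D_eq by (simp only: power_Suc) (simp add: field_simps)
  qed
qed

text \<open>For small \<delta>, choose \<open>t\<close> of the parity for which
  \<open>N t / D t\<close> lies on the same side of \<open>x\<close> as x + \<delta>, and such that
  convergents t and t + 2 enclose x + \<delta>. Two successive intermediate fractions between them
  then enclose it too, and \<open>quotient_lower_local\<close> applies.\<close>

lemma quotient_lower:
  assumes T: "1 \<le> T" and M: "0 \<le> M" "\<And>t i. T \<le> t \<Longrightarrow> i \<le> a (Suc t) \<Longrightarrow> M \<le> 2 * slope t i"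
  shows "\<forall>\<^sub>F \<delta> in at 0. M / 8 \<le> (question_mark (x + \<delta>) - question_mark x) / \<delta>"
proof -
  define d where "d t = side t * (real (N t) / real (D t) - x)" for t
  have d_pos: "0 < d t" if "1 \<le> t" for t
    unfolding d_def convergent_diff[OF that] using that D_pos[of "t - 1"] den_pos by auto
  have d_lim: "(\<lambda>t. d (Suc t)) \<longlonglongrightarrow> 0" unfolding d_def by (rule convergent_dist_tendsto)
  have side_add: "side (t + 2 * k) = side t" for t k
    by (induction k) (simp_all add: side_Suc)
  have "M / 8 \<le> (question_mark (x + \<delta>) - question_mark x) / \<delta>"
    if \<delta>: "\<delta> \<noteq> 0" "\<bar>\<delta>\<bar> < min (d T) (d (Suc T))" for \<delta>
  proof -
    obtain t0 where t0: "T \<le> t0" "side t0 * \<delta> = \<bar>\<delta>\<bar>" "\<bar>\<delta>\<bar> < d t0"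
    proof (cases "side T * \<delta> = \<bar>\<delta>\<bar>")
      case True
      then show thesis using that[of T] \<delta> by simp
    next
      case False
      then have "side (Suc T) * \<delta> = \<bar>\<delta>\<bar>" using side_cases[of T] side_Suc[of T] by (auto simp: abs_if split: if_splits)
      then show thesis using that[of "Suc T"] \<delta> by simp
    qed
    have "\<exists>k. d (t0 + 2 * Suc k) \<le> \<bar>\<delta>\<bar>"
    proof -
      have "\<forall>\<^sub>F t in sequentially. d (Suc t) < \<bar>\<delta>\<bar>"
        using order_tendstoD(2)[OF d_lim, of "\<bar>\<delta>\<bar>"] \<delta> by simp
      then obtain n where "\<And>t. n \<le> t \<Longrightarrow> d (Suc t) < \<bar>\<delta>\<bar>" unfolding eventually_sequentially by blast
      from this[of "t0 + 2 * n + 1"] show ?thesis by (intro exI[of _ n]) simp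
    qed
    then obtain k where k: "d (t0 + 2 * Suc k) \<le> \<bar>\<delta>\<bar>" "\<And>h. h < k \<Longrightarrow> \<not> d (t0 + 2 * Suc h) \<le> \<bar>\<delta>\<bar>"
      using exists_least_iff[of "\<lambda>k. d (t0 + 2 * Suc k) \<le> \<bar>\<delta>\<bar>"] by auto
    define t where "t = t0 + 2 * k"
    have t: "T \<le> t" "1 \<le> t" "side t * \<delta> = \<bar>\<delta>\<bar>"
      using t0 T side_add[of t0 k] unfolding t_def by auto
    have le: "\<bar>\<delta>\<bar> \<le> d t"
    proof (cases k)
      case 0
      then show ?thesis using t0 unfolding t_def by simp
    next
      case (Suc h)
      then show ?thesis using k(2)[of h] unfolding t_def by simp
    qed
    have ge: "d (Suc (Suc t)) \<le> \<bar>\<delta>\<bar>" using k(1) unfolding t_def by simp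
    let ?R = "\<lambda>i. real (N t + i * N (Suc t)) / real (D t + i * D (Suc t))"
    let ?B = "\<lambda>i. side t * ?R (Suc i) \<le> side t * (x + \<delta>)"
    have v: "side t * (x + \<delta>) = side t * x + \<bar>\<delta>\<bar>" using t(3) by (simp add: distrib_left)
    have "Suc (a (Suc t) - 1) = a (Suc t)" using a_pos[of t] by simp
    then have R_last: "?R (Suc (a (Suc t) - 1)) = real (N (Suc (Suc t))) / real (D (Suc (Suc t)))"
      by (simp add: add.commute)
    have "?B (a (Suc t) - 1)"
      using ge unfolding d_def side_Suc R_last v by (simp add: right_diff_distrib)
    define i where "i = (LEAST i. ?B i)"
    have i1: "?B i" unfolding i_def using \<open>?B (a (Suc t) - 1)\<close> by (rule LeastI)
    have i2: "i \<le> a (Suc t) - 1" unfolding i_def using \<open>?B (a (Suc t) - 1)\<close> by (rule Least_le)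
    have i3: "side t * (x + \<delta>) \<le> side t * ?R i"
    proof (cases i)
      case 0
      then show ?thesis using le unfolding d_def v by (simp add: right_diff_distrib)
    next
      case (Suc h)
      then show ?thesis using not_less_Least[of h ?B] unfolding i_def by simp
    qed
    have i4: "i < a (Suc t)" using i2 a_pos[of t] by simp
    have "M / 8 \<le> (question_mark (x + \<delta>) - question_mark x) / (x + \<delta> - x)"
      using t M i4 by (intro quotient_lower_local[OF t(2) i4 M(1) _ _ i1 i3]) auto
    then show ?thesis by simp
  qed
  moreover have "0 < min (d T) (d (Suc T))" using d_pos T by simp
  ultimately show ?thesis unfolding eventually_at by (intro exI[of _ "min (d T) (d (Suc T))"]) auto
qed

text \<open>The value of \<open>slope\<close> at the convergents: \<open>sigma t\<close> is
  \<open>slope t 0\<close>, and \<open>sigma (Suc t)\<close> is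
  \<open>slope t (a (Suc t))\<close>.\<close>

definition sigma :: "nat \<Rightarrow> real" where
  "sigma t = real (D (Suc t)) * real (D t) / 2 ^ S t"

text \<open>From i = 1 on, a further step at most doubles the denominator and always doubles the
  power of 2, so \<open>slope t\<close> decreases weakly. Its minimum over the run is therefore at
  one of the two ends.\<close>

lemma slope_ge:
  assumes "M \<le> sigma t" "M \<le> sigma (Suc t)" "i \<le> a (Suc t)"
  shows "M \<le> slope t i"
proof (cases "i = 0")
  case True
  then show ?thesis using assms unfolding slope_def sigma_def by simp
next
  case False
  have desc: "slope t (Suc k) \<le> slope t k" if "1 \<le> k" for k
  proof -
    have "1 * real (D (Suc t)) \<le> real k * real (D (Suc t))" using that by (intro mult_right_mono) auto
    then have "real (D t) + real (Suc k) * real (D (Suc t)) \<le> 2 * (real (D t) + real k * real (D (Suc t)))"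
      by (simp add: algebra_simps)
    then have "real (D (Suc t)) * (real (D t) + real (Suc k) * real (D (Suc t)))
       \<le> real (D (Suc t)) * (2 * (real (D t) + real k * real (D (Suc t))))" by (intro mult_left_mono) auto
    then have "real (D (Suc t)) * (real (D t) + real (Suc k) * real (D (Suc t))) / 2 ^ (S t + Suc k)
       \<le> real (D (Suc t)) * (2 * (real (D t) + real k * real (D (Suc t)))) / 2 ^ (S t + Suc k)"
      by (rule divide_right_mono) simp
    also have "\<dots> = slope t k" unfolding slope_def add_Suc_right power_Suc by (simp only: mult.left_commute mult_divide_mult_cancel_left_if) simp
    finally show ?thesis unfolding slope_def .
  qed
  have "slope t (i + m) \<le> slope t i" for m
  proof (induction m)
    case (Suc m)
    then show ?case using desc[of "i + m"] False by simp
  qed simp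
  from this[of "a (Suc t) - i"] have "slope t (a (Suc t)) \<le> slope t i" using assms(3) by simp
  moreover have "slope t (a (Suc t)) = sigma (Suc t)"
    unfolding slope_def sigma_def by (simp add: algebra_simps)
  ultimately show ?thesis using assms(2) by simp
qed

lemma ext_deriv_infinite:
  assumes "filterlim sigma at_top sequentially"
  shows "has_ext_deriv question_mark x \<infinity>"
  unfolding has_ext_deriv_def tendsto_PInfty
proof
  fix r :: real
  define M where "M = 8 * (\<bar>r\<bar> + 1)"
  have "\<forall>\<^sub>F t in sequentially. M \<le> sigma t" using assms by (simp add: filterlim_at_top)
  then obtain T where T: "\<And>t. T \<le> t \<Longrightarrow> M \<le> sigma t" unfolding eventually_sequentially by blast
  have M0: "0 \<le> M" unfolding M_def by simp
  have "M \<le> 2 * slope t i" if "max 1 T \<le> t" "i \<le> a (Suc t)" for t i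
    using slope_ge[OF T T that(2)] that M0 by simp
  then have "\<forall>\<^sub>F \<delta> in at 0. M / 8 \<le> (question_mark (x + \<delta>) - question_mark x) / \<delta>"
    using M0 by (intro quotient_lower[of "max 1 T"]) auto
  then show "\<forall>\<^sub>F \<delta> in at 0. ereal r < ereal ((question_mark (x + \<delta>) - question_mark x) / \<delta>)"
  proof eventually_elim
    case (elim \<delta>)
    have "r < M / 8" unfolding M_def by simp
    also note elim
    finally show ?case by (simp only: less_ereal.simps)
  qed
qed

end

section \<open>Growth of the denominators\<close>

definition golden :: real where
  "golden = (1 + sqrt 5) / 2"

lemma golden_square: "golden ^ 2 = golden + 1"
  unfolding golden_def by (simp add: power2_eq_square field_simps)

lemma golden_gt_1: "1 < golden"
  unfolding golden_def by simp

text \<open>Yields golden^2 > 13/5, which suffices for the comparisons with 2 and with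
  2^(5/4).\<close>

lemma golden_gt: "8 / 5 < golden"
proof -
  have "(11 / 5)\<^sup>2 < (5::real)" by (simp add: power2_eq_square)
  then have "11 / 5 < sqrt 5" by (rule real_less_rsqrt)
  then show ?thesis unfolding golden_def by simp
qed

text \<open>\<open>kappa1\<close> is the exponent with 2^kappa1 = golden^2; the logarithmic term
  becomes the factor \<open>t\<close>.\<close>

lemma two_powr_kappa1:
  assumes "1 \<le> t"
  shows "2 powr (kappa1 * real t + ln (real t) / ln 2) = golden ^ (2 * t) * real t"
proof -
  have "(kappa1 * real t + ln (real t) / ln 2) * ln 2 = real (2 * t) * ln golden + ln (real t)"
    unfolding kappa1_def golden_def by (simp add: field_simps)
  then have "2 powr (kappa1 * real t + ln (real t) / ln 2) = exp (real (2 * t) * ln golden) * exp (ln (real t))"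
    unfolding powr_def by (simp add: exp_add)
  also have "exp (real (2 * t) * ln golden) = golden ^ (2 * t)"
    using golden_gt_1 by (simp only: exp_of_nat_mult) simp
  finally show ?thesis using assms by simp
qed

lemma kappa1_gt_1: "1 < kappa1"
proof -
  have "2 powr 1 < 2 powr kappa1"
    using two_powr_kappa1[of 1] golden_square golden_gt by simp
  then show ?thesis by (rule powr_less_cancel) simp
qed

context cf_expansion
begin

lemma S_ge_real: "real t \<le> real (S t)"
  using S_ge of_nat_le_iff by blast

lemma S_diff_mono: "s \<le> t \<Longrightarrow> real (S s) - real s \<le> real (S t) - real t"
proof (induction t rule: dec_induct)
  case (step t)
  then show ?case using a_pos[of t] by simp
qed simp

text \<open>\<open>(golden, 1)\<close> is a left eigenvector of the Fibonacci matrix, so a partial quotient equal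
  to 1 multiplies this combination of denominators by \<open>golden\<close> exactly.\<close>

lemma golden_step:
  "golden * real (D (Suc (Suc t))) + real (D (Suc t)) =
     golden * (golden * real (D (Suc t)) + real (D t)) + golden * (real (a (Suc t)) - 1) * real (D (Suc t))"
proof -
  have "golden * golden = golden + 1" using golden_square by (simp add: power2_eq_square)
  then have "golden * (golden * real (D (Suc t))) = (golden + 1) * real (D (Suc t))"
    by (metis mult.assoc)
  then show ?thesis by (simp add: algebra_simps)
qed

lemma D_ge_golden: "golden ^ t \<le> golden * real (D (Suc t))"
proof (induction t rule: induct_nat_012)
  case 0
  show ?case using golden_gt_1 by simp
next
  case 1
  have "1 \<le> real (D (Suc (Suc 0)))" using D_pos[of "Suc 0"] by linarith
  then show ?case using golden_gt_1 by simp
next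
  case (ge2 t)
  have "golden ^ Suc (Suc t) = golden ^ Suc t + golden ^ t"
    using golden_square by (simp add: power2_eq_square algebra_simps flip: mult.assoc)
  also have "\<dots> \<le> golden * (real (D (Suc (Suc t))) + real (D (Suc t)))"
    using ge2 by (simp add: distrib_left)
  also have "\<dots> \<le> golden * real (D (Suc (Suc (Suc t))))"
  proof -
    have "1 * D (Suc (Suc t)) \<le> a (Suc (Suc t)) * D (Suc (Suc t))" using a_pos by (rule mult_le_mono1)
    then have "D (Suc (Suc t)) + D (Suc t) \<le> D (Suc (Suc (Suc t)))"
      unfolding conv_den.simps(3)[of a "Suc t"] by linarith
    then have "real (D (Suc (Suc t))) + real (D (Suc t)) \<le> real (D (Suc (Suc (Suc t))))"
      by (simp only: of_nat_add[symmetric] of_nat_le_iff)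
    then show ?thesis using golden_gt_1 by (intro mult_left_mono) auto
  qed
  finally show ?case .
qed

text \<open>By \<open>golden_step\<close>, a quotient a adds golden * (a - 1) * D to pure growth by
  \<open>golden\<close>, and golden * D is at least golden^t. These contributions accumulate to a
  factor linear in the excess S t - t.\<close>

lemma golden_combination_ge:
  "golden ^ t * (golden + (real (S t) - real t)) \<le> golden * (golden * real (D (Suc t)) + real (D t))"
proof (induction t)
  case 0
  show ?case using golden_gt_1 by simp
next
  case (Suc t)
  have a: "0 \<le> real (a (Suc t)) - 1" using a_pos[of t] by simp
  have "golden ^ Suc t * (golden + (real (S (Suc t)) - real (Suc t)))
      = golden * (golden ^ t * (golden + (real (S t) - real t))) + golden * (golden ^ t * (real (a (Suc t)) - 1))"
    by (simp add: algebra_simps)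
  also have "\<dots> \<le> golden * (golden * (golden * real (D (Suc t)) + real (D t)))
       + golden * (golden * real (D (Suc t)) * (real (a (Suc t)) - 1))"
    using Suc D_ge_golden[of t] a golden_gt_1 by (intro add_mono mult_left_mono mult_right_mono) auto
  also have "\<dots> = golden * (golden * real (D (Suc (Suc t))) + real (D (Suc t)))"
    unfolding golden_step by (simp add: algebra_simps)
  finally show ?case .
qed

lemma D_ge_excess: "golden ^ t * (1 + (real (S t) - real t)) \<le> golden ^ 3 * real (D (Suc t))"
proof -
  have "golden ^ t * (1 + (real (S t) - real t)) \<le> golden ^ t * (golden + (real (S t) - real t))"
    using golden_gt_1 by (intro mult_left_mono) auto
  also have "\<dots> \<le> golden * (golden * real (D (Suc t)) + real (D t))" by (rule golden_combination_ge)
  also have "\<dots> \<le> golden * (golden * real (D (Suc t)) + real (D (Suc t)))"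
    using D_mono_Suc[of t] golden_gt_1 by simp
  also have "\<dots> = golden * (golden ^ 2 * real (D (Suc t)))"
    unfolding golden_square by (simp add: algebra_simps)
  finally show ?thesis by (simp add: power3_eq_cube power2_eq_square mult.assoc)
qed

lemma sigma_lower:
  "golden ^ (2 * s + 1) * (1 + (real (S s) - real s)) * (1 + (real (S (Suc s)) - real (Suc s)))
     \<le> golden ^ 6 * 2 ^ S (Suc s) * sigma (Suc s)"
proof -
  have rearrange: "(c * u) * (d * v) = (c * d) * u * v" for c d u v :: real by simp
  have nonneg: "0 \<le> 1 + (real (S t) - real t)" for t
    using S_ge_real[of t] by linarith
  have "(golden ^ s * (1 + (real (S s) - real s))) * (golden ^ Suc s * (1 + (real (S (Suc s)) - real (Suc s))))
     \<le> (golden ^ 3 * real (D (Suc s))) * (golden ^ 3 * real (D (Suc (Suc s))))"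
    by (intro mult_mono D_ge_excess mult_nonneg_nonneg nonneg) (use golden_gt_1 in auto)
  also have "golden ^ s * golden ^ Suc s = golden ^ (2 * s + 1)"
    by (simp add: mult_2 power_add)
  then have "(golden ^ s * (1 + (real (S s) - real s))) * (golden ^ Suc s * (1 + (real (S (Suc s)) - real (Suc s))))
     = golden ^ (2 * s + 1) * (1 + (real (S s) - real s)) * (1 + (real (S (Suc s)) - real (Suc s)))"
    by (simp only: rearrange)
  also have "golden ^ 6 = golden ^ 3 * golden ^ 3" by (simp flip: power_add)
  then have "(golden ^ 3 * real (D (Suc s))) * (golden ^ 3 * real (D (Suc (Suc s))))
     = golden ^ 6 * (real (D (Suc s)) * real (D (Suc (Suc s))))"
    by simp
  also have "real (D (Suc s)) * real (D (Suc (Suc s))) = 2 ^ S (Suc s) * sigma (Suc s)"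
    unfolding sigma_def by simp
  finally show ?thesis by (simp only: ac_simps)
qed

lemma sigma_at_top:
  assumes bound: "\<And>t. 1 \<le> t \<Longrightarrow> real (S t) \<le> kappa1 * real t + ln (real t) / ln 2 + C"
  shows "filterlim sigma at_top sequentially"
proof -
  define B where "B t = real (S t) - real t" for t
  have B_nonneg: "0 \<le> B t" for t using S_ge_real[of t] unfolding B_def by linarith
  have B_mono: "s \<le> t \<Longrightarrow> B s \<le> B t" for s t using S_diff_mono unfolding B_def by blast
  \<comment> \<open>Growth rate of golden^(2t) against 2^(S t) when S t < 5t/4.\<close>
  define \<rho> where "\<rho> = golden ^ 2 / 2 powr (5 / 4)"
  have \<rho>: "1 < \<rho>"
  proof -
    have "(2 powr (5 / 4)) ^ 4 = (2::real) ^ 5" by (simp add: powr_power)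
    also have "\<dots> < (13 / 5) ^ 4" by (simp add: power_divide)
    also have "\<dots> \<le> (golden ^ 2) ^ 4" using golden_gt golden_square by (intro power_mono) auto
    finally have "2 powr (5 / 4) < golden ^ 2" by (rule power_less_imp_less_base) simp
    then show ?thesis unfolding \<rho>_def by simp
  qed
  note lower = sigma_lower[folded B_def]
  have low: "\<rho> ^ Suc s / golden ^ 7 \<le> sigma (Suc s)" if "4 * B (Suc s) < real (Suc s)" for s
  proof -
    have "(2::real) ^ S (Suc s) = 2 powr (real (S (Suc s)))" by (rule powr_realpow[symmetric]) simp
    also have "\<dots> \<le> 2 powr (5 / 4 * real (Suc s))"
      using that unfolding B_def by (intro powr_mono) (auto simp del: sum.cl_ivl_Suc)
    also have "\<dots> = (2 powr (5 / 4)) ^ Suc s" by (simp add: powr_power mult.commute del: power_Suc)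
    finally have two: "(2::real) ^ S (Suc s) \<le> (2 powr (5 / 4)) ^ Suc s" .
    have "golden ^ (2 * s + 1) * 1 * 1 \<le> golden ^ (2 * s + 1) * (1 + B s) * (1 + B (Suc s))"
      using B_nonneg golden_gt_1 by (intro mult_mono) auto
    also note lower
    also have "golden ^ 6 * 2 ^ S (Suc s) * sigma (Suc s) \<le> golden ^ 6 * (2 powr (5 / 4)) ^ Suc s * sigma (Suc s)"
      using two golden_gt_1 by (intro mult_right_mono mult_left_mono) (auto simp: sigma_def)
    finally have "golden ^ (2 * s + 1) \<le> golden ^ 6 * (2 powr (5 / 4)) ^ Suc s * sigma (Suc s)" by simp
    then have "golden * golden ^ (2 * s + 1) \<le> golden * (golden ^ 6 * (2 powr (5 / 4)) ^ Suc s * sigma (Suc s))"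
      using golden_gt_1 by (intro mult_left_mono) auto
    also have "golden * golden ^ (2 * s + 1) = (golden ^ 2) ^ Suc s"
      by (simp add: power2_eq_square power_mult_distrib mult_2 power_add)
    also have "\<dots> = \<rho> ^ Suc s * (2 powr (5 / 4)) ^ Suc s"
      unfolding \<rho>_def by (simp only: power_divide) simp
    also have "golden * (golden ^ 6 * (2 powr (5 / 4)) ^ Suc s * sigma (Suc s))
       = (golden ^ 7 * sigma (Suc s)) * (2 powr (5 / 4)) ^ Suc s"
      by (simp add: eval_nat_numeral)
    finally have "\<rho> ^ Suc s \<le> golden ^ 7 * sigma (Suc s)" by (simp only: mult_le_cancel_right) simp
    then show ?thesis using golden_gt_1 by (simp add: pos_divide_le_eq mult.commute)
  qed
  have high: "(1 + B s) / (4 * golden ^ 7 * 2 powr C) \<le> sigma (Suc s)"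
    if "real (Suc s) \<le> 4 * B (Suc s)" for s
  proof -
    have "(2::real) ^ S (Suc s) = 2 powr (real (S (Suc s)))" by (rule powr_realpow[symmetric]) simp
    also have "\<dots> \<le> 2 powr (kappa1 * real (Suc s) + ln (real (Suc s)) / ln 2 + C)"
      using bound[of "Suc s"] by (intro powr_mono) auto
    also have "\<dots> = golden ^ (2 * Suc s) * real (Suc s) * 2 powr C"
      unfolding powr_add[of 2 _ C] using two_powr_kappa1[of "Suc s"] by simp
    finally have two: "(2::real) ^ S (Suc s) \<le> golden ^ (2 * Suc s) * real (Suc s) * 2 powr C" .
    \<comment> \<open>The excess at s + 1 is at least (s + 1)/4 and cancels the factor
      \<open>Suc s\<close> in the bound for 2^S; the excess at s is left over.\<close>
    have "golden ^ (2 * s + 1) * (1 + B s) * (real (Suc s) / 4)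
      \<le> golden ^ (2 * s + 1) * (1 + B s) * (1 + B (Suc s))"
      using that B_nonneg[of s] golden_gt_1 by (intro mult_left_mono) auto
    also note lower
    also have "golden ^ 6 * 2 ^ S (Suc s) * sigma (Suc s)
       \<le> golden ^ 6 * (golden ^ (2 * Suc s) * real (Suc s) * 2 powr C) * sigma (Suc s)"
      using two golden_gt_1 by (intro mult_right_mono mult_left_mono) (auto simp: sigma_def)
    also have "\<dots> = (golden ^ (2 * s + 1) * real (Suc s)) * (golden ^ 7 * 2 powr C * sigma (Suc s))"
      by (simp add: eval_nat_numeral algebra_simps)
    also have "golden ^ (2 * s + 1) * (1 + B s) * (real (Suc s) / 4)
        = (golden ^ (2 * s + 1) * real (Suc s)) * ((1 + B s) / 4)" by simp
    finally have "(golden ^ (2 * s + 1) * real (Suc s)) * ((1 + B s) / 4)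
        \<le> (golden ^ (2 * s + 1) * real (Suc s)) * (golden ^ 7 * 2 powr C * sigma (Suc s))" .
    moreover have "0 < golden ^ (2 * s + 1) * real (Suc s)" using golden_gt_1 by simp
    ultimately have "(1 + B s) / 4 \<le> golden ^ 7 * 2 powr C * sigma (Suc s)"
      by (simp only: mult_le_cancel_left_pos)
    then show ?thesis using golden_gt_1 by (simp add: pos_divide_le_eq field_simps)
  qed
  have "\<forall>\<^sub>F s in sequentially. Z \<le> sigma (Suc s)" for Z
  proof -
    define K where "K = 4 * golden ^ 7 * 2 powr C * Z"
    \<comment> \<open>Either the excess eventually exceeds \<open>K\<close>, or it stays below
      \<open>K\<close> and the premise fails for large \<open>s\<close>.\<close>
    have "\<forall>\<^sub>F s in sequentially. real (Suc s) \<le> 4 * B (Suc s) \<longrightarrow> K \<le> B s"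
    proof (cases "\<exists>s. K \<le> B s")
      case True
      then obtain s0 where "K \<le> B s0" by blast
      then have "K \<le> B s" if "s0 \<le> s" for s using B_mono[OF that] by linarith
      then show ?thesis by (intro eventually_sequentiallyI[of s0]) blast
    next
      case False
      obtain n :: nat where n: "4 * K < real n" using reals_Archimedean2 by blast
      have "\<not> real (Suc s) \<le> 4 * B (Suc s)" if "n \<le> s" for s
      proof
        assume "real (Suc s) \<le> 4 * B (Suc s)"
        moreover have "B (Suc s) < K" using False not_le by blast
        moreover have "real n \<le> real s" using that by simp
        ultimately show False using n by simp
      qed
      then show ?thesis by (intro eventually_sequentiallyI[of n]) blast
    qed
    moreover have "\<forall>\<^sub>F s in sequentially. Z * golden ^ 7 \<le> \<rho> ^ Suc s"
    proof -
      obtain n where n: "Z * golden ^ 7 < \<rho> ^ n" using real_arch_pow[OF \<rho>] by blast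
      have "\<rho> ^ n \<le> \<rho> ^ Suc s" if "n \<le> s" for s
        using that \<rho> by (intro power_increasing) auto
      with n show ?thesis by (intro eventually_sequentiallyI[of n]) (metis less_imp_le order_trans)
    qed
    ultimately show ?thesis
    proof eventually_elim
      case (elim s)
      show ?case
      proof (cases "4 * B (Suc s) < real (Suc s)")
        case True
        have "Z \<le> \<rho> ^ Suc s / golden ^ 7" using elim(2) golden_gt_1 by (simp add: pos_le_divide_eq)
        then show ?thesis using low[OF True] by linarith
      next
        case False
        then have "K \<le> 1 + B s" using elim(1) by simp
        then have "Z \<le> (1 + B s) / (4 * golden ^ 7 * 2 powr C)"
          unfolding K_def using golden_gt_1 by (simp add: pos_le_divide_eq mult.commute)
        then show ?thesis using high[of s] False by linarith
      qed
    qed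
  qed
  then have "filterlim (\<lambda>s. sigma (Suc s)) at_top sequentially" by (simp add: filterlim_at_top)
  then show ?thesis by (rule filterlim_sequentially_Suc[THEN iffD1])
qed

end

section \<open>Points where the derivative does not exist\<close>

lemma cf_expansion_cf_quot:
  assumes "0 < x" "x < 1" "x \<notin> \<rat>"
  shows "cf_expansion x (cf_quot x) (\<lambda>t. (gauss_map ^^ t) x)"
proof -
  have iter: "0 < (gauss_map ^^ t) x \<and> (gauss_map ^^ t) x < 1 \<and> (gauss_map ^^ t) x \<notin> \<rat>" for t
  proof (induction t)
    case (Suc t)
    let ?z = "(gauss_map ^^ t) x"
    have step: "(gauss_map ^^ Suc t) x = frac (1 / ?z)" by (simp add: gauss_map_def[of ?z])
    have inv: "1 / ?z \<notin> \<rat>"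
    proof
      assume "1 / ?z \<in> \<rat>"
      from Rats_divide[OF Rats_1 this] Suc show False by simp
    qed
    then have "frac (1 / ?z) \<notin> \<rat>" unfolding frac_def
      using Rats_add[of "1 / ?z - of_int \<lfloor>1 / ?z\<rfloor>" "of_int \<lfloor>1 / ?z\<rfloor>"] by auto
    moreover from this have "frac (1 / ?z) \<noteq> 0" by (metis Rats_0)
    ultimately show ?case using frac_ge_0[of "1 / ?z"] frac_lt_1[of "1 / ?z"]
      unfolding step by (metis order_le_less)
  qed (use assms in simp)
  show ?thesis
  proof
    fix t
    let ?z = "(gauss_map ^^ t) x"
    have "0 \<le> \<lfloor>1 / ?z\<rfloor>" using iter[of t] by simp
    then have "real (cf_quot x (Suc t)) + (gauss_map ^^ Suc t) x = 1 / ?z"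
      by (simp add: cf_quot_def gauss_map_def frac_def)
    then show "?z = 1 / (real (cf_quot x (Suc t)) + (gauss_map ^^ Suc t) x)" by simp
  qed (use iter in auto)
qed

context cf_expansion
begin

lemma floor_y_inverse: "\<lfloor>1 / y t\<rfloor> = int (a (Suc t))"
  using y_pos[of "Suc t"] y_less_1[of "Suc t"] unfolding y_inverse by (simp add: floor_eq_iff)

lemma gauss_map_iterate: "(gauss_map ^^ t) x = y t"
proof (induction t)
  case (Suc t)
  have "gauss_map (y t) = y (Suc t)"
    unfolding gauss_map_def frac_def floor_y_inverse by (simp add: y_inverse)
  then show ?case using Suc by simp
qed (simp add: y_0)

lemma cf_quot_eq: "cf_quot x (Suc t) = a (Suc t)"
  unfolding cf_quot_def using floor_y_inverse[of t] gauss_map_iterate[of t] by simp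

lemma cf_sum_eq: "cf_sum x t = S t"
proof -
  have "cf_quot x i = a i" if "i \<in> {1..t}" for i
    using that cf_quot_eq[of "i - 1"] by simp
  then show ?thesis unfolding cf_sum_def by (intro sum.cong) auto
qed

text \<open>Infinite descent as in the Euclidean algorithm: y t = p/q gives y (t + 1) = (q - ap)/p,
  with a numerator below p.\<close>

lemma y_not_fraction: "0 < q \<Longrightarrow> y t \<noteq> real p / real q"
proof (induction p arbitrary: q t rule: less_induct)
  case (less p)
  show ?case
  proof
    assume eq: "y t = real p / real q"
    then have p: "0 < p" using y_pos[of t] by (cases "p = 0") auto
    have "y (Suc t) = real q / real p - real (a (Suc t))"
      using y_inverse[of t] eq by simp
    then have y': "y (Suc t) = (real q - real (a (Suc t) * p)) / real p" using p by (simp add: field_simps)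
    have "0 < real q - real (a (Suc t) * p)" using y_pos[of "Suc t"] p unfolding y' by (simp add: zero_less_divide_iff)
    then have le: "a (Suc t) * p \<le> q" by linarith
    have "real q - real (a (Suc t) * p) < real p" using y_less_1[of "Suc t"] p unfolding y' by simp
    then have "q - a (Suc t) * p < p" using le p by linarith
    from less.IH[OF this p, of "Suc t"] show False using y' le by (simp add: of_nat_diff)
  qed
qed

lemma x_irrational: "x \<notin> \<rat>"
proof
  assume "x \<in> \<rat>"
  then obtain m n :: nat where "n \<noteq> 0" "\<bar>x\<bar> = real m / real n" by (rule Rats_abs_nat_div_natE)
  then show False using y_not_fraction[of n 0 m] y_pos[of 0] y_0 by simp
qed

lemma convergents_at: "filterlim (\<lambda>t. real (N t) / real (D t) - x) (at 0) sequentially"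
proof -
  have "norm (side (Suc t) * (real (N (Suc t)) / real (D (Suc t)) - x)) =
      norm (real (N (Suc t)) / real (D (Suc t)) - x)" for t
    using side_cases[of "Suc t"] by auto
  then have "(\<lambda>t. norm (real (N (Suc t)) / real (D (Suc t)) - x)) \<longlonglongrightarrow> 0"
    using tendsto_norm_zero[OF convergent_dist_tendsto] by (simp only:)
  then have "(\<lambda>t. real (N (Suc t)) / real (D (Suc t)) - x) \<longlonglongrightarrow> 0" by (rule tendsto_norm_zero_cancel)
  moreover have "real (N (Suc t)) / real (D (Suc t)) - x \<noteq> 0" for t
    using x_irrational by auto
  ultimately have "filterlim (\<lambda>t. real (N (Suc t)) / real (D (Suc t)) - x) (at 0) sequentially"
    by (intro filterlim_atI always_eventually allI)
  then show ?thesis by (rule filterlim_sequentially_Suc[THEN iffD1])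
qed

section \<open>Oscillating \<open>sigma\<close> excludes a derivative\<close>

text \<open>Successive convergents lie on opposite sides of \<open>x\<close>, so the slope
  \<open>2 * sigma t\<close> between them is a weighted mean of the two difference quotients at
  \<open>x\<close>, with the distances \<open>u\<close> and \<open>v\<close> as weights.\<close>

lemma sigma_between_quotients:
  assumes t: "1 \<le> t"
  defines "\<delta> \<equiv> \<lambda>t. real (N t) / real (D t) - x"
  defines "quot \<equiv> \<lambda>h. (question_mark (x + h) - question_mark x) / h"
  shows "c < quot (\<delta> t) \<Longrightarrow> c < quot (\<delta> (Suc t)) \<Longrightarrow> c < 2 * sigma t"
    and "quot (\<delta> t) < c \<Longrightarrow> quot (\<delta> (Suc t)) < c \<Longrightarrow> 2 * sigma t < c"
proof -
  have edge: "stern_edge (S t - 1) (N (Suc t)) (D (Suc t)) (N t) (D t)"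
    using convergent_edge[OF t, of 0] by simp
  note diffs = stern_edge_signed(2,3)[OF edge side_def]
  define u where "u = side t * \<delta> t"
  define v where "v = - (side t * \<delta> (Suc t))"
  have u: "0 < u" unfolding u_def \<delta>_def convergent_diff[OF t]
    using t D_pos[of "t - 1"] den_pos by auto
  have "v = side (Suc t) * \<delta> (Suc t)" unfolding v_def side_Suc by simp
  then have v: "0 < v" unfolding \<delta>_def using convergent_diff[of "Suc t"] D_pos[of t] den_pos[of "Suc t"]
    by (simp del: conv_den.simps conv_num.simps)
  have uv: "u + v = 1 / (real (D (Suc t)) * real (D t))"
    unfolding u_def v_def \<delta>_def diffs(1)[symmetric] by (simp add: algebra_simps)
  have "\<delta> t \<noteq> 0" "\<delta> (Suc t) \<noteq> 0" using u v unfolding u_def v_def by auto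
  then have "quot (\<delta> t) * u = side t * (question_mark (x + \<delta> t) - question_mark x)"
    "quot (\<delta> (Suc t)) * v = - (side t * (question_mark (x + \<delta> (Suc t)) - question_mark x))"
    unfolding quot_def u_def v_def by simp_all
  then have "quot (\<delta> t) * u + quot (\<delta> (Suc t)) * v
      = side t * (question_mark (x + \<delta> t) - question_mark (x + \<delta> (Suc t)))"
    by (simp add: algebra_simps)
  also have "\<dots> = 1 / 2 ^ (S t - 1)" unfolding \<delta>_def using diffs(2) by simp
  also have "\<dots> = 2 * sigma t * (u + v)"
  proof -
    have "S t = Suc (S t - 1)" using S_ge[of t] t by simp
    then have "(2::real) ^ S t = 2 * 2 ^ (S t - 1)" by (metis power_Suc)
    then show ?thesis unfolding uv sigma_def using D_pos[of t] D_pos[of "t - 1"] t by simp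
  qed
  finally have eq: "quot (\<delta> t) * u + quot (\<delta> (Suc t)) * v = 2 * sigma t * (u + v)" .
  have uv0: "0 < u + v" using u v by simp
  show "c < 2 * sigma t" if "c < quot (\<delta> t)" "c < quot (\<delta> (Suc t))"
  proof -
    have "c * (u + v) < quot (\<delta> t) * u + quot (\<delta> (Suc t)) * v"
      unfolding distrib_left using that u v by (intro add_strict_mono mult_strict_right_mono)
    then show ?thesis unfolding eq using uv0 by (simp only: mult_less_cancel_right_pos)
  qed
  show "2 * sigma t < c" if "quot (\<delta> t) < c" "quot (\<delta> (Suc t)) < c"
  proof -
    have "quot (\<delta> t) * u + quot (\<delta> (Suc t)) * v < c * (u + v)"
      unfolding distrib_left using that u v by (intro add_strict_mono mult_strict_right_mono)
    then show ?thesis unfolding eq using uv0 by (simp only: mult_less_cancel_right_pos)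
  qed
qed

text \<open>Every \<open>L\<close> is above 3 or below 4. Accordingly \<open>2 * sigma t\<close>
  would eventually exceed 3 or eventually stay below 4, although it is infinitely often at most 2
  and infinitely often at least 4.\<close>

lemma no_ext_deriv:
  assumes large: "\<exists>\<^sub>F t in sequentially. 2 \<le> sigma t" and small: "\<exists>\<^sub>F t in sequentially. sigma t \<le> 1"
  shows "\<not> ext_deriv_exists question_mark x"
proof
  assume "ext_deriv_exists question_mark x"
  then obtain L where L: "((\<lambda>\<delta>. ereal ((question_mark (x + \<delta>) - question_mark x) / \<delta>)) \<longlongrightarrow> L) (at 0)"
    unfolding ext_deriv_exists_def has_ext_deriv_def by blast
  let ?quot = "\<lambda>h. (question_mark (x + h) - question_mark x) / h"
  let ?\<delta> = "\<lambda>t. real (N t) / real (D t) - x"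
  have lim: "(\<lambda>t. ereal (?quot (?\<delta> t))) \<longlonglongrightarrow> L"
    by (rule filterlim_compose[OF L convergents_at])
  note lim' = LIMSEQ_Suc[OF lim]
  have "ereal 3 < L \<or> L < ereal 4"
    using le_less_trans[of L "ereal 3" "ereal 4"] not_le by auto
  then show False
  proof
    assume "ereal 3 < L"
    from order_tendstoD(1)[OF lim this] order_tendstoD(1)[OF lim' this] eventually_ge_at_top[of 1]
    have "\<forall>\<^sub>F t in sequentially. \<not> sigma t \<le> 1"
    proof eventually_elim
      case (elim t)
      then have "3 < 2 * sigma t" by (intro sigma_between_quotients(1)) (simp_all only: less_ereal.simps)
      then show ?case by simp
    qed
    with small show False by (simp add: frequently_def)
  next
    assume "L < ereal 4"
    from order_tendstoD(2)[OF lim this] order_tendstoD(2)[OF lim' this] eventually_ge_at_top[of 1]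
    have "\<forall>\<^sub>F t in sequentially. \<not> 2 \<le> sigma t"
    proof eventually_elim
      case (elim t)
      then have "2 * sigma t < 4" by (intro sigma_between_quotients(2)) (simp_all only: less_ereal.simps)
      then show ?case by simp
    qed
    with large show False by (simp add: frequently_def)
  qed
qed

end

section \<open>Numbers with prescribed partial quotients\<close>

text \<open>All values of the continued fraction with first quotients a_1, ..., a_n and any tail in
  the closed unit interval; closedness provides compactness.\<close>

fun cf_box :: "(nat \<Rightarrow> nat) \<Rightarrow> nat \<Rightarrow> real set" where
  "cf_box a 0 = {0..1}"
| "cf_box a (Suc n) = (\<lambda>v. 1 / (real (a 1) + v)) ` cf_box (\<lambda>i. a (Suc i)) n"

lemma cf_box_nonneg: "v \<in> cf_box a n \<Longrightarrow> 0 \<le> v"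
  by (induction n arbitrary: a v) auto

lemma compact_cf_box: "(\<And>i. 1 \<le> a (Suc i)) \<Longrightarrow> compact (cf_box a n)"
proof (induction n arbitrary: a)
  case (Suc n)
  have "continuous_on (cf_box (\<lambda>i. a (Suc i)) n) (\<lambda>v. 1 / (real (a 1) + v))"
    proof (intro continuous_intros ballI)
    fix v assume "v \<in> cf_box (\<lambda>i. a (Suc i)) n"
    then show "real (a 1) + v \<noteq> 0" using Suc.prems[of 0] cf_box_nonneg[of v] by fastforce
  qed
  moreover have "compact (cf_box (\<lambda>i. a (Suc i)) n)"
    by (rule Suc.IH) (rule Suc.prems)
  ultimately show ?case by (simp add: compact_continuous_image)
qed simp

lemma cf_box_decreasing: "(\<And>i. 1 \<le> a (Suc i)) \<Longrightarrow> cf_box a (Suc n) \<subseteq> cf_box a n"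
proof (induction n arbitrary: a)
  case 0
  have "1 / (real (a 1) + v) \<le> 1" if "0 \<le> v" for v
    using 0[of 0] that by simp
  then show ?case by auto
next
  case (Suc n)
  have "cf_box (\<lambda>i. a (Suc i)) (Suc n) \<subseteq> cf_box (\<lambda>i. a (Suc i)) n"
    by (rule Suc.IH) (rule Suc.prems)
  then show ?case by (simp only: cf_box.simps(2)[of a]) blast
qed

text \<open>\<open>x\<close> is a common point of the nested compact boxes. Its tails lie in the
  boxes of the shifted sequences, which makes them positive, and positivity of the next tail gives
  \<open>y t < 1\<close>.\<close>

lemma cf_expansion_exists:
  assumes a: "\<And>i. 1 \<le> a (Suc i)"
  shows "\<exists>x y. cf_expansion x a y"
proof -
  have "\<Inter> (range (cf_box a)) \<noteq> {}"
  proof (rule compact_nest)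
    show "compact (cf_box a n)" for n using a by (rule compact_cf_box)
    show "cf_box a n \<noteq> {}" for n by (induction n arbitrary: a) auto
    show "cf_box a n \<subseteq> cf_box a m" if "m \<le> n" for m n
      using that cf_box_decreasing[of a, OF a] by (rule lift_Suc_antimono_le[rotated])
  qed
  then obtain x where x: "\<And>n. x \<in> cf_box a n" by blast
  define y where "y = rec_nat x (\<lambda>t z. 1 / z - real (a (Suc t)))"
  have y: "y 0 = x" "y (Suc t) = 1 / y t - real (a (Suc t))" for t
    unfolding y_def by simp_all
  have box: "y t \<in> cf_box (\<lambda>i. a (i + t)) n" for t n
  proof (induction t arbitrary: n)
    case 0
    then show ?case using x y by simp
  next
    case (Suc t)
    obtain v where v: "v \<in> cf_box (\<lambda>i. a (i + Suc t)) n" "y t = 1 / (real (a (Suc t)) + v)"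
      using Suc[of "Suc n"] by auto
    then have "y (Suc t) = v" using y(2)[of t] by simp
    then show ?case using v by simp
  qed
  have pos: "0 < y t" for t
  proof -
    obtain v where v: "0 \<le> v" "y t = 1 / (real (a (Suc t)) + v)"
      using box[of t 1] by auto
    then show ?thesis using a[of t] by (simp add: add_pos_nonneg)
  qed
  have eq: "y t = 1 / (real (a (Suc t)) + y (Suc t))" for t
    using y(2)[of t] by simp
  have "y t < 1" for t
  proof -
    have "1 < real (a (Suc t)) + y (Suc t)" using a[of t] pos[of "Suc t"] by linarith
    then show ?thesis by (subst eq) simp
  qed
  with pos eq y(1) have "cf_expansion x a y" by unfold_locales
  then show ?thesis by blast
qed

text \<open>The choice of a quotient depends on the earlier ones only through three numbers, so
  primitive recursion on this triple is enough.\<close>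

lemma exists_recursive_quotients:
  "\<exists>a :: nat \<Rightarrow> nat. \<forall>t. a (Suc t) = c t (\<Sum>i = 1..t. a i) (conv_den a (Suc t)) (conv_den a t)"
proof -
  define st where "st = rec_nat (0, 1, 0) (\<lambda>t (s, q, q'). (s + c t s q q', c t s q q' * q + q', q :: nat))"
  define a where "a t = (case t of 0 \<Rightarrow> 0 | Suc t \<Rightarrow> (case st t of (s, q, q') \<Rightarrow> c t s q q'))" for t
  have st: "st t = ((\<Sum>i = 1..t. a i), conv_den a (Suc t), conv_den a t)" for t
  proof (induction t)
    case 0
    show ?case by (simp add: st_def)
  next
    case (Suc t)
    have "st (Suc t) = (case st t of (s, q, q') \<Rightarrow> (s + c t s q q', c t s q q' * q + q', q))"
      by (simp add: st_def)
    moreover have "a (Suc t) = (case st t of (s, q, q') \<Rightarrow> c t s q q')" by (simp add: a_def)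
    ultimately show ?case unfolding Suc by simp
  qed
  show ?thesis
    by (rule exI[of _ a]) (simp add: a_def[of "Suc _"] st del: conv_den.simps)
qed

section \<open>Quotients that make \<open>sigma\<close> oscillate\<close>

text \<open>Taking \<open>b\<close> as the next quotient turns \<open>sigma t \<ge> 2\<close> into \<open>sigma (Suc t) \<le> 1\<close>.\<close>

definition admissible :: "(nat \<Rightarrow> real) \<Rightarrow> nat \<Rightarrow> nat \<Rightarrow> nat \<Rightarrow> nat \<Rightarrow> nat \<Rightarrow> bool" where
  "admissible \<psi> t s q q' b \<longleftrightarrow> 1 \<le> b \<and> 2 * 2 ^ s \<le> real q * real q' \<and>
     real (s + b) \<le> kappa1 * real (Suc t) + ln (real (Suc t)) / ln 2 + \<psi> (Suc t) \<and>
     real (b * q + q') * real q \<le> 2 ^ (s + b)"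

context cf_expansion
begin

lemma S_ones:
  assumes "\<And>t. T \<le> t \<Longrightarrow> a (Suc t) = 1"
  shows "S (T + k) = S T + k"
  using assms by (induction k) auto

lemma D_ones_le:
  assumes ones: "\<And>t. T \<le> t \<Longrightarrow> a (Suc t) = 1"
  shows "golden * real (D (Suc (T + k))) \<le> golden ^ k * (golden * real (D (Suc T)) + real (D T))"
proof -
  have "golden * real (D (Suc (T + k))) + real (D (T + k)) = golden ^ k * (golden * real (D (Suc T)) + real (D T))"
  proof (induction k)
    case (Suc k)
    show ?case using golden_step[of "T + k"] ones[of "T + k"] Suc by simp
  qed simp
  then show ?thesis by linarith
qed

text \<open>Each quotient 1 multiplies 2^S by 2, while the product of denominators grows like
  golden^(2t), and golden^2 > 2.\<close>

lemma sigma_ones: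
  assumes ones: "\<And>t. T \<le> t \<Longrightarrow> a (Suc t) = 1" and T: "1 \<le> T"
  shows "\<forall>\<^sub>F t in sequentially. 2 * 2 ^ S t \<le> real (D (Suc t)) * real (D t)"
proof -
  have "1 < golden ^ 2 / 2" using golden_square golden_gt by simp
  then obtain n where n: "2 * 2 ^ S T * golden ^ 2 < (golden ^ 2 / 2) ^ n" using real_arch_pow by blast
  have "2 * 2 ^ S t \<le> real (D (Suc t)) * real (D t)" if t: "T + n \<le> t" for t
  proof -
    define k where "k = t - T"
    have k: "t = T + k" "n \<le> k" using t unfolding k_def by auto
    obtain r where r: "t = Suc r" using t T by (cases t) auto
    have kr: "2 * k \<le> r + Suc r" using k r T by simp
    have "(golden ^ 2 / 2) ^ n \<le> (golden ^ 2 / 2) ^ k"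
      using k \<open>1 < golden ^ 2 / 2\<close> by (intro power_increasing) auto
    with n have "2 * 2 ^ S T * golden ^ 2 * 2 ^ k \<le> (golden ^ 2 / 2) ^ k * 2 ^ k"
      by (intro mult_right_mono) auto
    also have "\<dots> = golden ^ (2 * k)" by (simp add: power_divide power_mult)
    also have "\<dots> \<le> golden ^ (r + Suc r)" using kr golden_gt_1 by (intro power_increasing) auto
    also have "\<dots> = golden ^ r * golden ^ t" unfolding r by (rule power_add)
    also have "\<dots> \<le> (golden * real (D t)) * (golden * real (D (Suc t)))"
      unfolding r using golden_gt_1 by (intro mult_mono D_ge_golden) auto
    also have "\<dots> = (real (D (Suc t)) * real (D t)) * golden ^ 2" by (simp add: power2_eq_square)
    finally have "(2 * 2 ^ (S T + k)) * golden ^ 2 \<le> (real (D (Suc t)) * real (D t)) * golden ^ 2"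
      by (simp add: power_add mult.commute mult.left_commute)
    then have "2 * 2 ^ (S T + k) \<le> real (D (Suc t)) * real (D t)"
      using golden_gt_1 by (subst (asm) mult_le_cancel_right_pos) auto
    then show ?thesis using S_ones[of T k, OF ones] unfolding k(1) by simp
  qed
  then show ?thesis by (rule eventually_sequentiallyI)
qed

text \<open>Choose \<open>b\<close> so that the new sum exceeds the bound without \<psi> by about a
  constant \<open>n\<close>. Then 2^(S t + b) is above 2^n * golden^(2t) * t, which dominates the
  new product of denominators because b = O(t) and \<open>D (Suc t)\<close> is O(golden^t).
  Eventually \<psi> is large enough to allow the extra \<open>n\<close>.\<close>

lemma admissible_after_ones:
  assumes ones: "\<And>t. T \<le> t \<Longrightarrow> a (Suc t) = 1" and T: "1 \<le> T"
    and \<psi>: "filterlim \<psi> at_top sequentially"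
  shows "\<exists>t\<ge>T. \<exists>b. admissible \<psi> t (S t) (D (Suc t)) (D t) b"
proof -
  define W where "W = (golden * real (D (Suc T)) + real (D T)) / golden"
  have D_le: "real (D (Suc (T + k))) \<le> golden ^ k * W" for k
    using D_ones_le[of T k, OF ones] golden_gt_1 unfolding W_def by (simp add: field_simps)
  obtain n where n: "(kappa1 + 1) * W ^ 2 < 2 ^ n" using real_arch_pow[of 2] by auto
  \<comment> \<open>The logarithm outgrows constants, which makes b \<ge> 1, but stays below
    \<open>t\<close>, which bounds s + 1 by (kappa1 + 1)(t + 1).\<close>
  have "\<forall>\<^sub>F t in sequentially. K \<le> ln (real (Suc t)) / ln 2"
    "\<forall>\<^sub>F t in sequentially. ln (real (Suc t)) / ln 2 + K \<le> real (Suc t)" for K :: real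
    by real_asymp+
  from this(1)[of "real (S T) + 1"] this(2)[of "real n + 2"]
  have "\<forall>\<^sub>F t in sequentially. real (S T) + 1 \<le> ln (real (Suc t)) / ln 2"
    "\<forall>\<^sub>F t in sequentially. ln (real (Suc t)) / ln 2 + (real n + 2) \<le> real (Suc t)" .
  moreover have "\<forall>\<^sub>F t in sequentially. real n + 1 \<le> \<psi> (Suc t)"
    using \<psi> by (intro eventually_compose_filterlim[OF _ filterlim_Suc]) (simp add: filterlim_at_top)
  moreover have "\<forall>\<^sub>F t in sequentially. 2 * 2 ^ S t \<le> real (D (Suc t)) * real (D t)"
    using ones T by (rule sigma_ones)
  moreover note eventually_ge_at_top[of T]
  ultimately
  have "\<forall>\<^sub>F t in sequentially. t \<ge> T \<and> (\<exists>b. admissible \<psi> t (S t) (D (Suc t)) (D t) b)"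
  proof eventually_elim
    case (elim t)
    define k where "k = t - T"
    have t: "t = T + k" using elim(5) unfolding k_def by simp
    have S: "S t = S T + k" unfolding t by (rule S_ones[of T k, OF ones])
    define \<beta> where "\<beta> = kappa1 * real (Suc t) + ln (real (Suc t)) / ln 2"
    define s where "s = nat \<lfloor>\<beta> + real n + 1\<rfloor>"
    have kt: "real (Suc t) \<le> kappa1 * real (Suc t)" using kappa1_gt_1 by simp
    have "0 \<le> \<beta> + real n + 1" using kt elim(1) unfolding \<beta>_def by linarith
    then have s: "real s \<le> \<beta> + real n + 1" "\<beta> + real n < real s"
      unfolding s_def by linarith+
    have "real (S t) < real s"
    proof -
      have "real (S t) = real (S T) + real k" by (simp only: S of_nat_add)
      moreover have "real k < real (Suc t)" unfolding t by simp
      ultimately show ?thesis using s(2) kt elim(1) unfolding \<beta>_def by linarith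
    qed
    then have "S t < s" by (simp only: of_nat_less_iff)
    define b where "b = s - S t"
    have b: "1 \<le> b" "S t + b = s" using \<open>S t < s\<close> unfolding b_def by auto
    have "real (b * D (Suc t) + D t) \<le> (real s + 1) * real (D (Suc t))"
    proof -
      have "b * D (Suc t) + D t \<le> s * D (Suc t) + D (Suc t)"
        using b(2) D_mono_Suc[of t] by (intro add_mono mult_right_mono) auto
      then have "real (b * D (Suc t) + D t) \<le> real (s * D (Suc t) + D (Suc t))" by (simp only: of_nat_le_iff)
      then show ?thesis by (simp add: algebra_simps)
    qed
    also have "\<dots> \<le> (kappa1 + 1) * real (Suc t) * real (D (Suc t))"
      using s(1) elim(2) unfolding \<beta>_def by (intro mult_right_mono) (simp_all add: algebra_simps)
    finally have "real (b * D (Suc t) + D t) * real (D (Suc t))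
       \<le> (kappa1 + 1) * real (Suc t) * real (D (Suc t)) * real (D (Suc t))"
      by (rule mult_right_mono) simp
    also have "\<dots> \<le> (kappa1 + 1) * real (Suc t) * (golden ^ k * W) * (golden ^ k * W)"
      using D_le[of k] kappa1_gt_1 unfolding t by (intro mult_mono mult_nonneg_nonneg order_trans[OF _ D_le[of k]]) auto
    also have "\<dots> = ((kappa1 + 1) * W ^ 2) * (golden ^ (2 * k) * real (Suc t))"
      by (simp add: power2_eq_square mult_2 power_add)
    also have "\<dots> \<le> 2 ^ n * (golden ^ (2 * Suc t) * real (Suc t))"
      using n golden_gt_1 unfolding t by (intro mult_mono power_increasing mult_nonneg_nonneg) auto
    also have "\<dots> = 2 powr (\<beta> + real n)"
      unfolding \<beta>_def powr_add[of 2 _ "real n"] two_powr_kappa1[of "Suc t", simplified] 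
      using two_powr_kappa1[of "Suc t"] by (simp add: powr_realpow)
    also have "\<dots> \<le> 2 powr (real s)" using s(2) by (intro powr_mono) auto
    also have "\<dots> = 2 ^ s" by (rule powr_realpow) simp
    finally have "real (b * D (Suc t) + D t) * real (D (Suc t)) \<le> 2 ^ (S t + b)" unfolding b(2) .
    moreover have "real (S t + b) \<le> \<beta> + \<psi> (Suc t)" using s(1) elim(3) unfolding b(2) by linarith
    ultimately have "admissible \<psi> t (S t) (D (Suc t)) (D t) b"
      using b(1) elim(4) unfolding admissible_def \<beta>_def by blast
    then show ?case using elim(5) by blast
  qed
  then show ?thesis using eventually_happens'[OF sequentially_bot] by blast
qed

end

text \<open>Since kappa1 > 1, the bound rises by at least 1 per step, so a quotient 1 never violates
  a bound that held before.\<close>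

lemma cf_bound_step:
  assumes "mono_on {1..} \<psi>" "1 \<le> t"
  shows "kappa1 * real t + ln (real t) / ln 2 + \<psi> t + 1
    \<le> kappa1 * real (Suc t) + ln (real (Suc t)) / ln 2 + \<psi> (Suc t)"
proof -
  have "\<psi> t \<le> \<psi> (Suc t)" using assms by (intro mono_onD[OF assms(1)]) auto
  moreover have "ln (real t) / ln 2 \<le> ln (real (Suc t)) / ln 2"
    using assms(2) by (intro divide_right_mono) auto
  moreover have "kappa1 * real (Suc t) = kappa1 * real t + kappa1" by (simp add: algebra_simps)
  ultimately show ?thesis using kappa1_gt_1 by linarith
qed

lemma exists_no_ext_deriv:
  assumes mono: "mono_on {1..} \<psi>" and lim: "filterlim \<psi> at_top sequentially"
  shows "\<exists>x. 0 < x \<and> x < 1 \<and> x \<notin> \<rat> \<and> \<not> ext_deriv_exists question_mark x \<and>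
     (\<forall>t\<ge>1. cf_sum x t = t \<or> real (cf_sum x t) \<le> kappa1 * real t + ln (real t) / ln 2 + \<psi> t)"
proof -
  define c where "c t s q q' =
    (if \<exists>b. admissible \<psi> t s q q' b then SOME b. admissible \<psi> t s q q' b else 1)" for t s q q'
  obtain a where a: "\<And>t. a (Suc t) = c t (\<Sum>i = 1..t. a i) (conv_den a (Suc t)) (conv_den a t)"
    using exists_recursive_quotients[of c] by blast
  define good where "good t \<longleftrightarrow> (\<exists>b. admissible \<psi> t (\<Sum>i = 1..t. a i) (conv_den a (Suc t)) (conv_den a t) b)" for t
  have good: "admissible \<psi> t (\<Sum>i = 1..t. a i) (conv_den a (Suc t)) (conv_den a t) (a (Suc t))" if "good t" for t
    using that someI_ex unfolding good_def a[of t] c_def by (simp add: someI_ex del: conv_den.simps)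
  have bad: "a (Suc t) = 1" if "\<not> good t" for t
    unfolding a[of t] c_def using that[unfolded good_def] by (rule if_not_P)
  have "1 \<le> a (Suc t)" for t
  proof (cases "good t")
    case True
    then show ?thesis using good unfolding admissible_def by blast
  next
    case False
    then show ?thesis using bad by simp
  qed
  then obtain x y where "cf_expansion x a y" using cf_expansion_exists by blast
  then interpret cf_expansion x a y .
  \<comment> \<open>If admissible choices ceased, all later quotients would be 1, and
    \<open>admissible_after_ones\<close> would supply another one.\<close>
  have often: "\<exists>\<^sub>F t in sequentially. good t"
  proof (rule ccontr)
    assume "\<not> (\<exists>\<^sub>F t in sequentially. good t)"
    then obtain T where T: "\<And>t. T \<le> t \<Longrightarrow> \<not> good t"
      unfolding not_frequently eventually_sequentially by blast
    have "\<exists>t\<ge>max 1 T. \<exists>b. admissible \<psi> t (S t) (D (Suc t)) (D t) b"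
      using T bad by (intro admissible_after_ones lim) auto
    then show False using T unfolding good_def by auto
  qed
  have large: "2 \<le> sigma t" if "good t" for t
    using good[OF that] unfolding admissible_def sigma_def by (simp add: pos_le_divide_eq)
  have small: "sigma (Suc t) \<le> 1" if "good t" for t
    using good[OF that] unfolding admissible_def sigma_def by simp
  have "\<exists>\<^sub>F t in sequentially. 2 \<le> sigma t"
    using often by (rule frequently_elim1) (rule large)
  moreover have "\<exists>\<^sub>F t in sequentially. sigma (Suc t) \<le> 1"
    using often by (rule frequently_elim1) (rule small)
  then have "\<exists>\<^sub>F t in sequentially. sigma t \<le> 1"
    unfolding frequently_def by (simp add: eventually_sequentially_Suc[of "\<lambda>t. \<not> sigma t \<le> 1"])
  ultimately have "\<not> ext_deriv_exists question_mark x" by (rule no_ext_deriv)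
  \<comment> \<open>Until the first admissible choice all quotients are 1 and
    \<open>S t = t\<close>. Such a choice establishes the bound, and quotients 1 preserve
    it.\<close>
  moreover have "S t = t \<or> 1 \<le> t \<and> real (S t) \<le> kappa1 * real t + ln (real t) / ln 2 + \<psi> t" for t
  proof (induction t)
    case (Suc t)
    have S_Suc: "S (Suc t) = S t + a (Suc t)" by simp
    show ?case
    proof (cases "good t")
      case True
      then show ?thesis using good[OF True] unfolding admissible_def S_Suc by simp
    next
      case False
      then have "S (Suc t) = S t + 1" using bad by simp
      with Suc cf_bound_step[OF mono, of t] show ?thesis by auto
    qed
  qed simp
  moreover have "0 < x" "x < 1" using y_pos[of 0] y_less_1[of 0] y_0 by auto
  ultimately show ?thesis using x_irrational unfolding cf_sum_eq[symmetric] by blast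
qed

theorem theorem1:
  shows "(\<forall>x::real. 0 < x \<and> x < 1 \<and> x \<notin> \<rat> \<and>
            (\<exists>C::real. \<forall>t\<ge>1. real (cf_sum x t) \<le> kappa1 * real t + ln (real t) / ln 2 + C) \<longrightarrow>
            has_ext_deriv question_mark x \<infinity>)
       \<and> (\<forall>\<psi> :: nat \<Rightarrow> real.
            mono_on {1..} \<psi> \<and> filterlim \<psi> at_top sequentially \<longrightarrow>
            (\<exists>x::real. 0 < x \<and> x < 1 \<and> x \<notin> \<rat> \<and>
               \<not> ext_deriv_exists question_mark x \<and>
               (\<forall>t\<ge>1. real t \<le> kappa1 * real t + ln (real t) / ln 2 + \<psi> t \<longrightarrow>
                  real (cf_sum x t) \<le> kappa1 * real t + ln (real t) / ln 2 + \<psi> t)))"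
proof (intro conjI allI impI)
  fix x :: real
  assume *: "0 < x \<and> x < 1 \<and> x \<notin> \<rat> \<and>
    (\<exists>C::real. \<forall>t\<ge>1. real (cf_sum x t) \<le> kappa1 * real t + ln (real t) / ln 2 + C)"
  then interpret cf_expansion x "cf_quot x" "\<lambda>t. (gauss_map ^^ t) x"
    by (intro cf_expansion_cf_quot) auto
  from * show "has_ext_deriv question_mark x \<infinity>"
    unfolding cf_sum_def using sigma_at_top ext_deriv_infinite by blast
next
  fix \<psi> :: "nat \<Rightarrow> real"
  assume "mono_on {1..} \<psi> \<and> filterlim \<psi> at_top sequentially"
  \<comment> \<open>Where \<open>cf_sum x t = t\<close>, the premise on \<open>t\<close> is itself
    the required bound.\<close>
  then show "\<exists>x::real. 0 < x \<and> x < 1 \<and> x \<notin> \<rat> \<and> \<not> ext_deriv_exists question_mark x \<and>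
      (\<forall>t\<ge>1. real t \<le> kappa1 * real t + ln (real t) / ln 2 + \<psi> t \<longrightarrow>
         real (cf_sum x t) \<le> kappa1 * real t + ln (real t) / ln 2 + \<psi> t)"
    using exists_no_ext_deriv[of \<psi>] by metis
qed

end
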